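(* Let $M\in\mathbb N$, $\mathcal A\subset\{0,\dots,M-1\}$ with $1<|\mathcal A|<M$, $\chi\in C_0^\infty((0,1);[0,1])$, and $\delta=\log|\mathcal A|/\log M$. For $k\in\mathbb N$, $N=M^k$, and $\nu\ge0$ let $\mathcal N_k(\nu)$ be the number of eigenvalues $\lambda$ of the open quantum baker's map $B_N=B_{N,\chi}$, counted with (algebraic) multiplicity, satisfying $|\lambda|\ge M^{-\nu}$. Then for each $\nu>0$ and each $\varepsilon>0$, as $k\to\infty$, $$\mathcal N_k(\nu)=\mathcal O\big(N^{m(\delta,\nu)+\varepsilon}\big),\qquad m(\delta,\nu)=\min(2\nu+2\delta-1,\ \delta).$$
   Context: $\mathbb Z_N=\mathbb Z/N\mathbb Z\simeq\{0,\dots,N-1\}$; $\ell^2_N$ is the space of functions $u:\mathbb Z_N\to\mathbb C$ with $\|u\|_{\ell^2_N}^2=\sum_{j=0}^{N-1}|u(j)|^2$. The unitary Fourier transform is $\mathcal F_Nu(j)=\frac1{\sqrt N}\sum_{\ell=0}^{N-1}\exp(-2\pi ij\ell/N)u(\ell)$. For $\chi\in C_0^\infty((0,1);[0,1])$ (extended by zero), $\chi_N$ is the multiplication operator on $\ell^2_N$ by $\chi_N(j)=\chi(j/N)$, $j\in\{0,\dots,N-1\}$. Open quantum baker's map: for $N=M^k$, $k\in\mathbb N$, and $a\in\{0,\dots,M-1\}$, let $\Pi_a:\ell^2_N\to\ell^2_{N/M}$, $\Pi_au(j)=u(j+aN/M)$ for $j\in\{0,\dots,N/M-1\}$. Then $$B_N=B_{N,\chi}=\sum_{a\in\mathcal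 A}\mathcal F_N^*\,\Pi_a^*\,\chi_{N/M}\,\mathcal F_{N/M}\,\chi_{N/M}\,\Pi_a:\ell^2_N\to\ell^2_N.$$ The implied constant in $\mathcal O$ may depend on $M,\mathcal A,\chi,\nu,\varepsilon$ but not on $k$. *)

theory Defs
  imports
    "HOL-Analysis.Derivative"
    "HOL-Library.Landau_Symbols"
    "Jordan_Normal_Form.Schur_Decomposition"
begin

definition smooth_real :: "(real \<Rightarrow> real) \<Rightarrow> bool" where
  "smooth_real f \<longleftrightarrow> (\<forall>n. (deriv ^^ n) f differentiable_on UNIV)"

text \<open>A cutoff in \<open>C\<^sub>0\<^sup>\<infinity>((0,1); [0,1])\<close>, given as its extension by zero to the whole line.\<close>

definition cutoff :: "(real \<Rightarrow> real) \<Rightarrow> bool" where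
  "cutoff chi \<longleftrightarrow> smooth_real chi \<and> range chi \<subseteq> {0..1} \<and>
     compact (closure {x. chi x \<noteq> 0}) \<and> closure {x. chi x \<noteq> 0} \<subseteq> {0<..<1}"

text \<open>
  The space \<open>\<ell>\<^sup>2\<^sub>N\<close> is represented by complex vectors of dimension \<open>N\<close> with coordinates
  \<open>0, \<dots>, N - 1\<close>, and operators by their matrices in the standard basis.  This basis is
  orthonormal, so the Hilbert space adjoint is the conjugate transpose \<open>mat_adjoint\<close>.
\<close>

definition fourier_mat :: "nat \<Rightarrow> complex mat" where
  "fourier_mat N = Matrix.mat N N
     (\<lambda>(j, l). exp (- 2 * of_real pi * \<i> * of_nat j * of_nat l / of_nat N) / of_real (sqrt (real N)))"

definition cutoff_mat :: "(real \<Rightarrow> real) \<Rightarrow> nat \<Rightarrow> complex mat" where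
  "cutoff_mat chi N = mat_diag N (\<lambda>j. of_real (chi (real j / real N)))"

definition proj_mat :: "nat \<Rightarrow> nat \<Rightarrow> nat \<Rightarrow> complex mat" where
  "proj_mat M N a = Matrix.mat (N div M) N (\<lambda>(j, l). if l = j + a * (N div M) then 1 else 0)"

text \<open>The three matrices act on vectors by the expected formulas.\<close>

lemma fourier_mat_apply:
  assumes "u \<in> carrier_vec N" "j < N"
  shows "vec_index (fourier_mat N *\<^sub>v u) j =
    1 / of_real (sqrt (real N)) *
      (\<Sum>l<N. exp (- 2 * of_real pi * \<i> * of_nat j * of_nat l / of_nat N) * vec_index u l)"
  using assms
  by (simp add: fourier_mat_def scalar_prod_def sum_distrib_left lessThan_atLeast0)

lemma cutoff_mat_apply:
  assumes "u \<in> carrier_vec N" "j < N"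
  shows "vec_index (cutoff_mat chi N *\<^sub>v u) j = of_real (chi (real j / real N)) * vec_index u j"
  using assms
  by (simp add: cutoff_mat_def mat_diag_def scalar_prod_def if_distrib[of "\<lambda>c. c * _"] cong: if_cong)

lemma proj_mat_apply:
  assumes "u \<in> carrier_vec N" "M dvd N" "a < M" "j < N div M"
  shows "vec_index (proj_mat M N a *\<^sub>v u) j = vec_index u (j + a * (N div M))"
proof -
  have "j + a * (N div M) < Suc a * (N div M)"
    using assms by simp
  also have "\<dots> \<le> M * (N div M)"
    using assms by (intro mult_right_mono) auto
  finally have "j + a * (N div M) < N"
    using assms by simp
  then show ?thesis
    using assms
    by (simp add: proj_mat_def scalar_prod_def if_distrib[of "\<lambda>c. c * _"] cong: if_cong)
qed

text \<open>Matrices do not form a monoid as a type, so the sum over the alphabet is taken entrywise.\<close>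

definition baker_mat :: "nat \<Rightarrow> nat set \<Rightarrow> (real \<Rightarrow> real) \<Rightarrow> nat \<Rightarrow> complex mat" where
  "baker_mat M \<A> chi N = Matrix.mat N N (\<lambda>ij. \<Sum>a\<in>\<A>.
     (mat_adjoint (fourier_mat N) * mat_adjoint (proj_mat M N a) * cutoff_mat chi (N div M) *
        fourier_mat (N div M) * cutoff_mat chi (N div M) * proj_mat M N a) $$ ij)"

definition eigenvalue_count :: "complex mat \<Rightarrow> real \<Rightarrow> nat" where
  "eigenvalue_count B r =
     (\<Sum>z | eigenvalue B z \<and> r \<le> cmod z. Polynomial.order z (char_poly B))"

lemma finite_eigenvalues:
  assumes "(B :: complex mat) \<in> carrier_mat n n"
  shows "finite {z. eigenvalue B z \<and> r \<le> cmod z}"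
proof (rule finite_subset)
  show "{z. eigenvalue B z \<and> r \<le> cmod z} \<subseteq> {z. poly (char_poly B) z = 0}"
    using eigenvalue_root_char_poly[OF assms] by auto
  have "char_poly B \<noteq> 0"
    using degree_monic_char_poly[OF assms] by auto
  then show "finite {z. poly (char_poly B) z = 0}"
    by (rule poly_roots_finite)
qed

definition baker_count :: "nat \<Rightarrow> nat set \<Rightarrow> (real \<Rightarrow> real) \<Rightarrow> nat \<Rightarrow> real \<Rightarrow> nat" where
  "baker_count M \<A> chi k \<nu> = eigenvalue_count (baker_mat M \<A> chi (M ^ k)) (real M powr (- \<nu>))"

end

theory Submission
  imports Defs "HOL-Analysis.L2_Norm" "HOL-Analysis.Complex_Transcendental"
begin

text \<open>
  Write \<open>N = M\<^sup>k\<close>, \<open>n = N / M\<close>, and \<open>B\<close> for the matrix of the baker's map. The proof bounds the number of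
  eigenvalues by Hilbert-Schmidt norms, starting from Schur's inequality: the sum of the squared moduli of the
  eigenvalues of a matrix is at most its squared Hilbert-Schmidt norm (\<open>schur_inequality\<close>). It is
  applied to a power \<open>B\<^sup>m\<close> conjugated by a diagonal matrix \<open>S\<close>, which yields
  \<open>\<N> M\<^sup>-\<^sup>2\<^sup>\<nu>\<^sup>m \<le> \<parallel>S\<^sup>-\<^sup>1 B\<^sup>m S\<parallel>\<^sup>2\<close> for the eigenvalue count \<open>\<N>\<close> (\<open>eigenvalue_count_le_hs_norm\<close>).

  Dynamics enters through the decay of the entries of \<open>B\<close>. By repeated summation by parts, the entry
  at \<open>(i, j)\<close> is \<open>O(\<bar>i - M (j mod n)\<bar>\<^sup>-\<^sup>K)\<close> for every \<open>K\<close>, and it vanishes if the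
  first digit \<open>j div n\<close> is outside the alphabet (\<open>baker_mat_decay\<close>, \<open>baker_mat_outside\<close>). With a tolerance
  \<open>L = N\<^sup>\<tau>\<close>, one application of \<open>B\<close> therefore follows the expanding map within
  distance \<open>L\<close>, up to an operator whose norm is smaller than any power of \<open>1 / N\<close>. Let \<open>X\<close> be the set of points that
  can be followed for about \<open>k\<close> steps; it is a thickened Cantor set with
  at most a constant times \<open>N\<^sup>\<delta>\<^sup>+\<^sup>\<tau>\<close> elements (\<open>card_trapped\<close>). The powers of \<open>B\<close> are far from normal, but the
  part that leaves \<open>X\<close> is nilpotent up to a tiny error, so it has
  almost no influence on the eigenvalues. The weights in \<open>S\<close> make this precise: they grade the points by
  the time for which they can be followed and reduce the estimate to the block
  \<open>1\<^sub>X B\<^sup>m 1\<^sub>X\<close> (\<open>eigenvalue_count_propagation\<close>).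

  This block is estimated in two ways.

  \<^item> Its squared norm is at most \<open>card X\<close>, because \<open>B\<close> is a contraction. For this estimate \<open>m\<close> may
    be as small as about \<open>k / q\<close>, if \<open>X\<close> is built from \<open>q\<close> stages of \<open>m\<close> steps; then \<open>M\<^sup>2\<^sup>\<nu>\<^sup>m\<close> is of order \<open>N\<close> to the power \<open>2 \<nu> / q\<close>,
    and large \<open>q\<close> gives the exponent \<open>\<delta>\<close>.

  \<^item> With \<open>F\<close> the Fourier transform, \<open>F B F\<^sup>*\<close> is the transpose of \<open>B\<close>
    (\<open>baker_mat_pow_fourier\<close>). Hence \<open>B\<^sup>m\<close> is localised to \<open>X\<close> in frequency as well,
    and for \<open>m\<close> about \<open>k\<close> the block has norm at most that of \<open>1\<^sub>X F\<^sup>* 1\<^sub>X\<close>, which is \<open>card X / sqrt N\<close>, up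
    to a tiny error (\<open>hs_norm_baker_uncertainty\<close>). As \<open>M\<^sup>2\<^sup>\<nu>\<^sup>m\<close> is now of order \<open>N\<^sup>2\<^sup>\<nu>\<close>, this gives the
    exponent \<open>2 \<nu> + 2 \<delta> - 1\<close>.
\<close>

section \<open>Adjoints and the Hilbert-Schmidt norm\<close>

lemma dim_mat_adjoint [simp]:
  "dim_row (mat_adjoint A) = dim_col A" "dim_col (mat_adjoint A) = dim_row A"
  by (auto simp: mat_adjoint_def)

lemma mat_adjoint_carrier [simp]: "mat_adjoint A \<in> carrier_mat m n \<longleftrightarrow> A \<in> carrier_mat n m"
  unfolding carrier_mat_def by auto

lemma index_mat_adjoint [simp]:
  fixes A :: "complex mat"
  assumes "i < dim_col A" "j < dim_row A"
  shows "mat_adjoint A $$ (i, j) = cnj (A $$ (j, i))"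
  using assms by (simp add: mat_adjoint_def mat_of_rows_index)

lemma mat_adjoint_adjoint [simp]: "mat_adjoint (mat_adjoint A) = (A :: complex mat)"
  by (rule eq_matI) auto

lemma mat_adjoint_mult:
  fixes A B :: "complex mat"
  assumes "A \<in> carrier_mat l m" "B \<in> carrier_mat m n"
  shows "mat_adjoint (A * B) = mat_adjoint B * mat_adjoint A"
  using assms by (intro eq_matI) (auto simp: scalar_prod_def mult.commute intro!: sum.cong)

text \<open>
  The Hilbert-Schmidt norm is preferred to the operator norm throughout: it controls all eigenvalues
  at once, and it can be bounded entry by entry.
\<close>

definition hs_norm :: "complex mat \<Rightarrow> real" where
  "hs_norm A = L2_set (\<lambda>(i, j). cmod (A $$ (i, j))) ({..<dim_row A} \<times> {..<dim_col A})"

lemma hs_norm_nonneg [simp]: "0 \<le> hs_norm A"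
  by (simp add: hs_norm_def L2_set_nonneg)

lemma hs_norm_sq: "A \<in> carrier_mat n m \<Longrightarrow> (hs_norm A)\<^sup>2 = (\<Sum>i<n. \<Sum>j<m. (cmod (A $$ (i, j)))\<^sup>2)"
  by (auto simp: hs_norm_def L2_set_def case_prod_unfold sum_nonneg sum.cartesian_product)

lemma hs_norm_triangle:
  assumes "A \<in> carrier_mat n m" "B \<in> carrier_mat n m"
  shows "hs_norm (A + B) \<le> hs_norm A + hs_norm B"
proof -
  have "hs_norm (A + B) \<le> L2_set (\<lambda>ij. cmod (A $$ ij) + cmod (B $$ ij)) ({..<n} \<times> {..<m})"
    unfolding hs_norm_def using assms by (auto intro!: L2_set_mono simp: norm_triangle_ineq)
  also have "\<dots> \<le> L2_set (\<lambda>ij. cmod (A $$ ij)) ({..<n} \<times> {..<m}) + L2_set (\<lambda>ij. cmod (B $$ ij)) ({..<n} \<times> {..<m})"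
    by (rule L2_set_triangle_ineq)
  also have "\<dots> = hs_norm A + hs_norm B"
    using assms by (auto simp: hs_norm_def case_prod_unfold)
  finally show ?thesis .
qed

lemma hs_norm_mono:
  assumes "A \<in> carrier_mat n m" "B \<in> carrier_mat n m"
    and "\<And>i j. i < n \<Longrightarrow> j < m \<Longrightarrow> cmod (A $$ (i, j)) \<le> cmod (B $$ (i, j))"
  shows "hs_norm A \<le> hs_norm B"
  using assms unfolding hs_norm_def by (auto intro!: L2_set_mono)

lemma cmod_le_hs_norm:
  assumes "A \<in> carrier_mat n m" "i < n" "j < m"
  shows "cmod (A $$ (i, j)) \<le> hs_norm A"
  using assms member_le_L2_set[of "{..<n} \<times> {..<m}" "(i, j)" "\<lambda>(i, j). cmod (A $$ (i, j))"]
  by (auto simp: hs_norm_def)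

lemma hs_norm_le_bound:
  assumes "A \<in> carrier_mat n n" "0 \<le> c" "\<And>i j. i < n \<Longrightarrow> j < n \<Longrightarrow> cmod (A $$ (i, j)) \<le> c"
  shows "hs_norm A \<le> real n * c"
proof (rule power2_le_imp_le)
  have "(hs_norm A)\<^sup>2 \<le> (\<Sum>i<n. \<Sum>j<n. c\<^sup>2)"
    unfolding hs_norm_sq[OF assms(1)] using assms by (intro sum_mono power_mono) auto
  then show "(hs_norm A)\<^sup>2 \<le> (real n * c)\<^sup>2"
    by (simp add: power2_eq_square algebra_simps)
qed (use assms in auto)

lemma hs_norm_transpose [simp]: "hs_norm (transpose_mat A) = hs_norm A"
proof -
  have A: "A \<in> carrier_mat (dim_row A) (dim_col A)" by auto
  have "(hs_norm (transpose_mat A))\<^sup>2 = (hs_norm A)\<^sup>2"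
    unfolding hs_norm_sq[OF A] hs_norm_sq[of "transpose_mat A" "dim_col A" "dim_row A", simplified]
    by (subst sum.swap) (auto intro!: sum.cong)
  then show ?thesis by simp
qed

lemma hs_norm_adjoint [simp]: "hs_norm (mat_adjoint A) = hs_norm A"
proof -
  have A: "A \<in> carrier_mat (dim_row A) (dim_col A)" by auto
  have "(hs_norm (mat_adjoint A))\<^sup>2 = (hs_norm A)\<^sup>2"
    unfolding hs_norm_sq[OF A] hs_norm_sq[of "mat_adjoint A" "dim_col A" "dim_row A", simplified]
    by (subst sum.swap) (auto intro!: sum.cong)
  then show ?thesis by simp
qed

lemma cnj_times_self: "cnj z * z = of_real ((cmod z)\<^sup>2)"
  using complex_norm_square[of z] by (metis mult.commute)

text \<open>
  In this form the norm is visibly invariant under unitary factors, which cancel inside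
  the product of adjoint and matrix.
\<close>

lemma hs_norm_sq_trace:
  assumes "A \<in> carrier_mat n m"
  shows "of_real ((hs_norm A)\<^sup>2) = (\<Sum>j<m. (mat_adjoint A * A) $$ (j, j))"
proof -
  have "(mat_adjoint A * A) $$ (j, j) = (\<Sum>i<n. of_real ((cmod (A $$ (i, j)))\<^sup>2))" if "j < m" for j
    using that assms
    by (simp add: scalar_prod_def cnj_times_self lessThan_atLeast0 del: of_real_power)
  then show ?thesis
    unfolding hs_norm_sq[OF assms] of_real_sum by (subst sum.swap) simp
qed

lemma hs_norm_unitary_left:
  assumes "U \<in> carrier_mat n n" "A \<in> carrier_mat n m" "mat_adjoint U * U = 1\<^sub>m n"
  shows "hs_norm (U * A) = hs_norm A"
proof -
  have "mat_adjoint (U * A) * (U * A) = mat_adjoint A * ((mat_adjoint U * U) * A)"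
    using assms(1,2)
    by (simp add: mat_adjoint_mult[of _ n n _ m] assoc_mult_mat[of _ m n _ n _ m] assoc_mult_mat[of _ n n _ n _ m])
  also have "\<dots> = mat_adjoint A * A"
    using assms by simp
  finally have "of_real ((hs_norm (U * A))\<^sup>2) = (of_real ((hs_norm A)\<^sup>2) :: complex)"
    using assms hs_norm_sq_trace[of "U * A" n m] hs_norm_sq_trace[of A n m] by simp
  then show ?thesis
    unfolding of_real_eq_iff by simp
qed

lemma hs_norm_unitary_right:
  assumes "U \<in> carrier_mat n n" "A \<in> carrier_mat m n" "U * mat_adjoint U = 1\<^sub>m n"
  shows "hs_norm (A * U) = hs_norm A"
proof -
  have "hs_norm (A * U) = hs_norm (mat_adjoint U * mat_adjoint A)"
    using assms mat_adjoint_mult[of A m n U n] hs_norm_adjoint[of "A * U"] by simp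
  then show ?thesis
    using assms hs_norm_unitary_left[of "mat_adjoint U" n "mat_adjoint A" m] by simp
qed

section \<open>Schur's inequality\<close>

text \<open>
  Complete \<open>v\<close> to a basis and orthogonalise it. Gram-Schmidt returns orthogonal vectors
  of arbitrary length, so the columns are divided by their norms afterwards.
\<close>

lemma unitary_with_first_column:
  fixes v :: "complex vec"
  assumes v: "v \<in> carrier_vec n" "v \<noteq> 0\<^sub>v n"
  obtains U c where "U \<in> carrier_mat n n" "mat_adjoint U * U = 1\<^sub>m n" "U * mat_adjoint U = 1\<^sub>m n"
    "col U 0 = c \<cdot>\<^sub>v v"
proof -
  interpret cof_vec_space n "TYPE(complex)" .
  define b where "b = basis_completion v"
  from basis_completion[OF v, folded b_def]
  have b: "distinct b" "\<not> lin_dep (set b)" "set b \<subseteq> carrier_vec n" "hd b = v" "length b = n"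
    by auto
  have "n \<noteq> 0" using v by auto
  then obtain vs where bv: "b = v # vs" using b by (cases b) auto
  define ws where "ws = gram_schmidt n b"
  from gram_schmidt_result[OF b(3,1,2) refl, folded ws_def]
  have ws: "set ws \<subseteq> carrier_vec n" "corthogonal ws" "length ws = n"
    by (auto simp: b)
  have hdws: "ws ! 0 = v"
    using gram_schmidt_hd[OF v(1), of vs, folded bv] ws \<open>n \<noteq> 0\<close> unfolding ws_def
    by (metis hd_conv_nth length_0_conv)
  have wsc: "ws ! j \<in> carrier_vec n" if "j < n" for j
    using ws that by auto
  define nrm where "nrm j = sqrt (\<Sum>k<n. (cmod (ws ! j $ k))\<^sup>2)" for j
  have dot: "(\<Sum>k<n. cnj (ws ! i $ k) * ws ! j $ k) = (if i = j then of_real ((nrm j)\<^sup>2) else 0)"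
    if "i < n" "j < n" for i j
  proof (cases "i = j")
    case True
    have "of_real ((nrm j)\<^sup>2) = (\<Sum>k<n. of_real ((cmod (ws ! j $ k))\<^sup>2) :: complex)"
      by (simp add: nrm_def sum_nonneg)
    with True show ?thesis
      by (simp add: cnj_times_self del: of_real_power)
  next
    case False
    have "ws ! j \<bullet>c ws ! i = 0"
      using ws that False unfolding corthogonal_def by auto
    with False wsc[OF that(1)] wsc[OF that(2)] show ?thesis
      by (simp add: scalar_prod_def lessThan_atLeast0 mult.commute)
  qed
  have nz: "nrm j \<noteq> 0" if j: "j < n" for j
  proof
    assume 0: "nrm j = 0"
    have "ws ! j \<bullet>c ws ! j = (\<Sum>k<n. cnj (ws ! j $ k) * ws ! j $ k)"
      using wsc[OF j] by (simp add: scalar_prod_def lessThan_atLeast0 mult.commute)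
    also have "\<dots> = 0" using dot[OF j j] 0 by simp
    finally show False using ws j unfolding corthogonal_def by auto
  qed
  define U where "U = Matrix.mat n n (\<lambda>(i, j). ws ! j $ i / of_real (nrm j))"
  have U: "U \<in> carrier_mat n n" by (simp add: U_def)
  have UU: "mat_adjoint U * U = 1\<^sub>m n"
  proof (rule eq_matI)
    fix i j assume "i < dim_row (1\<^sub>m n :: complex mat)" "j < dim_col (1\<^sub>m n :: complex mat)"
    then have ij: "i < n" "j < n" by auto
    have "(mat_adjoint U * U) $$ (i, j) = (\<Sum>k<n. cnj (ws ! i $ k) * ws ! j $ k) / (nrm i * nrm j)"
      using ij by (simp add: U_def scalar_prod_def lessThan_atLeast0 sum_divide_distrib)
    also have "\<dots> = (if i = j then 1 else 0)"
      using nz[OF ij(1)] nz[OF ij(2)] unfolding dot[OF ij] by (simp add: power2_eq_square)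
    finally show "(mat_adjoint U * U) $$ (i, j) = 1\<^sub>m n $$ (i, j)"
      using ij by simp
  qed (auto simp: U_def)
  have UU': "U * mat_adjoint U = 1\<^sub>m n"
    using mat_mult_left_right_inverse[OF _ U UU] U by simp
  have "col U 0 = (1 / of_real (nrm 0)) \<cdot>\<^sub>v v"
    using \<open>n \<noteq> 0\<close> v hdws by (auto intro!: eq_vecI simp: U_def)
  with U UU UU' that show ?thesis by blast
qed

text \<open>
  Deflation: conjugation by a unitary matrix whose first column is an eigenvector for \<open>e\<close> leaves
  the norm unchanged and produces the column \<open>(e, 0, \<dots>, 0)\<close>. The lower right block has the
  remaining eigenvalues, and its entries are disjoint from the corner entry \<open>e\<close>, so the squares
  simply add up.
\<close>

lemma schur_inequality:
  fixes A :: "complex mat"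
  assumes "A \<in> carrier_mat n n" "char_poly A = (\<Prod>a\<leftarrow>es. [:- a, 1:])"
  shows "(\<Sum>a\<leftarrow>es. (cmod a)\<^sup>2) \<le> (hs_norm A)\<^sup>2"
  using assms
proof (induction es arbitrary: n A)
  case Nil
  then show ?case by simp
next
  case (Cons e es)
  note A = Cons.prems(1)
  have "eigenvalue A e"
    unfolding eigenvalue_root_char_poly[OF A] Cons.prems(2) by simp
  then obtain v where v: "v \<in> carrier_vec n" "v \<noteq> 0\<^sub>v n" "A *\<^sub>v v = e \<cdot>\<^sub>v v"
    using A unfolding eigenvalue_def eigenvector_def by auto
  obtain U c where U: "U \<in> carrier_mat n n" "mat_adjoint U * U = 1\<^sub>m n" "U * mat_adjoint U = 1\<^sub>m n"
    and Uv: "col U 0 = c \<cdot>\<^sub>v v"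
    using unitary_with_first_column[OF v(1,2)] by metis
  define A' where "A' = mat_adjoint U * (A * U)"
  have n: "n \<noteq> 0" using v by auto
  have A': "A' \<in> carrier_mat n n" using A U by (simp add: A'_def)
  have hsA: "hs_norm A' = hs_norm A"
    unfolding A'_def using A U
    by (simp add: hs_norm_unitary_left[of _ n _ n] hs_norm_unitary_right[of _ n _ n])
  have "similar_mat_wit A' A (mat_adjoint U) U"
    using A A' U by (intro similar_mat_witI[of _ _ n]) (auto simp: A'_def assoc_mult_mat[of _ n n _ n _ n])
  then have cp: "char_poly A' = [:- e, 1:] * (\<Prod>a\<leftarrow>es. [:- a, 1:])"
    using Cons.prems(2) char_poly_similar[of A' A] unfolding similar_mat_def by auto
  have "col A' 0 = mat_adjoint U *\<^sub>v (A *\<^sub>v col U 0)"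
    using A U n col_mult2[of "mat_adjoint U" n n "A * U" n 0] col_mult2[of A n n U n 0]
    by (simp only: A'_def mat_adjoint_carrier mult_carrier_mat neq0_conv)
  also have "A *\<^sub>v col U 0 = e \<cdot>\<^sub>v col U 0"
    using A v by (simp add: Uv mult_mat_vec[of _ n n] smult_smult_assoc mult.commute)
  also have "mat_adjoint U *\<^sub>v (e \<cdot>\<^sub>v col U 0) = e \<cdot>\<^sub>v col (mat_adjoint U * U) 0"
    using U(1) n col_mult2[of "mat_adjoint U" n n U n 0] mult_mat_vec[of "mat_adjoint U" n n "col U 0" e]
    by (metis bot_nat_0.not_eq_extremum carrier_matD(1) col_dim mat_adjoint_carrier)
  finally have col0: "col A' 0 = e \<cdot>\<^sub>v unit_vec n 0"
    using U n by simp
  have ent: "A' $$ (i, 0) = (if i = 0 then e else 0)" if "i < n" for i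
  proof -
    have "A' $$ (i, 0) = col A' 0 $ i" using A' n that by simp
    then show ?thesis using that n by (simp add: col0)
  qed
  obtain n1 where n1: "n = Suc n1" using n by (cases n) auto
  obtain A1 A2 A0 A3 where split: "split_block A' 1 1 = (A1, A2, A0, A3)"
    by (cases "split_block A' 1 1") auto
  have sb: "A1 \<in> carrier_mat 1 1" "A2 \<in> carrier_mat 1 n1" "A0 \<in> carrier_mat n1 1"
    "A3 \<in> carrier_mat n1 n1" "A' = four_block_mat A1 A2 A0 A3"
    using split_block[OF split, of n1 n1] A' n1 by auto
  have A1: "A1 = Matrix.mat 1 1 (\<lambda>_. e)"
    using split ent[of 0] n A' by (auto simp: split_block_def Let_def)
  have A0: "A0 = 0\<^sub>m n1 1"
    using split ent A' n1 by (auto simp: split_block_def Let_def)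
  have "char_poly A' = char_poly A1 * char_poly A3"
    unfolding sb(5) A0 by (rule char_poly_four_block_zeros_col[OF sb(1,2,4)])
  also have "char_poly A1 = [:- e, 1:]"
    by (simp add: A1 char_poly_defs det_def sign_def)
  finally have "char_poly A3 = (\<Prod>a\<leftarrow>es. [:- a, 1:])"
    using cp by (metis mult_cancel_left pCons_eq_0_iff zero_neq_one)
  from Cons.IH[OF sb(4) this] have IH: "(\<Sum>a\<leftarrow>es. (cmod a)\<^sup>2) \<le> (hs_norm A3)\<^sup>2" .
  have "(cmod e)\<^sup>2 + (hs_norm A3)\<^sup>2 \<le> (hs_norm A')\<^sup>2"
  proof -
    have A3e: "A3 $$ (i, j) = A' $$ (Suc i, Suc j)" if "i < n1" "j < n1" for i j
      using split A' n1 that by (auto simp: split_block_def Let_def)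
    have "(hs_norm A')\<^sup>2 = (\<Sum>j<Suc n1. (cmod (A' $$ (0, j)))\<^sup>2)
        + (\<Sum>i<n1. \<Sum>j<Suc n1. (cmod (A' $$ (Suc i, j)))\<^sup>2)"
      unfolding hs_norm_sq[OF A'] n1 by (subst sum.lessThan_Suc_shift) simp
    moreover have "(\<Sum>j<Suc n1. (cmod (A' $$ (0, j)))\<^sup>2) \<ge> (cmod e)\<^sup>2"
      using ent[of 0] n by (subst sum.lessThan_Suc_shift) (simp add: sum_nonneg)
    moreover have "(\<Sum>i<n1. \<Sum>j<Suc n1. (cmod (A' $$ (Suc i, j)))\<^sup>2) \<ge> (hs_norm A3)\<^sup>2"
      unfolding hs_norm_sq[OF sb(4)]
      by (intro sum_mono, subst sum.lessThan_Suc_shift) (simp add: A3e)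
    ultimately show ?thesis by simp
  qed
  with IH hsA show ?case by simp
qed

text \<open>
  This turns the sum of algebraic multiplicities into a count over the list of roots, which is
  the form that \<open>schur_inequality\<close> speaks about.
\<close>

lemma eigenvalue_count_eq_length:
  assumes A: "A \<in> carrier_mat n n" and cp: "char_poly A = (\<Prod>a\<leftarrow>es. [:- a, 1:])"
  shows "eigenvalue_count A r = length (filter (\<lambda>a. r \<le> cmod a) es)"
proof -
  have ord: "Polynomial.order z (char_poly A) = count_list es z" for z
  proof -
    have "Polynomial.order z (\<Prod>a\<leftarrow>es. [:- a, 1:]) = (\<Sum>a\<leftarrow>es. Polynomial.order z [:- a, 1:])"
      by (subst order_prod_list) (auto simp: o_def)
    also have "\<dots> = (\<Sum>a\<leftarrow>es. if a = z then 1 else 0)"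
      using order_power_n_n[of z 1] by (auto intro!: arg_cong[where f = sum_list] simp: order_0I)
    also have "\<dots> = count_list es z"
      by (induction es) auto
    finally show ?thesis using cp by simp
  qed
  have set: "{z. eigenvalue A z \<and> r \<le> cmod z} = set (filter (\<lambda>a. r \<le> cmod a) es)"
    unfolding eigenvalue_root_char_poly[OF A] cp by (auto simp: poly_prod_list prod_list_zero_iff)
  have "eigenvalue_count A r = (\<Sum>z\<in>set (filter (\<lambda>a. r \<le> cmod a) es). count_list (filter (\<lambda>a. r \<le> cmod a) es) z)"
    unfolding eigenvalue_count_def set ord
  proof (rule sum.cong)
    fix z assume "z \<in> set (filter (\<lambda>a. r \<le> cmod a) es)"
    then have "r \<le> cmod z" by auto
    then show "count_list es z = count_list (filter (\<lambda>a. r \<le> cmod a) es) z"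
      by (induction es) auto
  qed simp
  then show ?thesis by (simp add: sum_count_set)
qed

text \<open>
  The diagonal of a power of a triangular matrix consists of the powers of the diagonal entries.
\<close>

lemma char_poly_pow:
  fixes A :: "complex mat"
  assumes A: "A \<in> carrier_mat n n" and cp: "char_poly A = (\<Prod>a\<leftarrow>es. [:- a, 1:])"
  shows "char_poly (A ^\<^sub>m m) = (\<Prod>a\<leftarrow>es. [:- (a ^ m), 1:])"
proof -
  obtain T P Q where "schur_decomposition A es = (T, P, Q)"
    by (cases "schur_decomposition A es") auto
  from schur_decomposition[OF A cp this]
  have sim: "similar_mat_wit A T P Q" and ut: "upper_triangular T" and dg: "diag_mat T = es"
    by auto
  from similar_mat_witD2[OF A sim] have T: "T \<in> carrier_mat n n" by auto
  have Tm: "T ^\<^sub>m m \<in> carrier_mat n n" using T by simp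
  have tri: "(\<forall>i<n. \<forall>j<i. (T ^\<^sub>m m) $$ (i, j) = 0) \<and> (\<forall>i<n. (T ^\<^sub>m m) $$ (i, i) = (T $$ (i, i)) ^ m)"
  proof (induction m)
    case 0
    then show ?case using T by auto
  next
    case (Suc m)
    let ?S = "T ^\<^sub>m m"
    have S: "?S \<in> carrier_mat n n" using T by simp
    have prod: "(?S * T) $$ (i, j) = (\<Sum>k<n. ?S $$ (i, k) * T $$ (k, j))" if "i < n" "j < n" for i j
      using that S T by (simp add: scalar_prod_def lessThan_atLeast0)
    have Tz: "T $$ (k, j) = 0" if "j < k" "k < n" for j k
      using ut T that by auto
    have z: "?S $$ (i, k) * T $$ (k, j) = 0" if "i < n" "j \<le> i" "k < n" "\<not> (k = i \<and> j = i)" for i j k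
      using Suc.IH Tz[of j k] that by (cases "k < i") auto
    have "(?S * T) $$ (i, j) = 0" if "i < n" "j < i" for i j
      using that z[of i j] prod[of i j] by (auto intro!: sum.neutral)
    moreover have "(?S * T) $$ (i, i) = (T $$ (i, i)) ^ Suc m" if "i < n" for i
    proof -
      have "(?S * T) $$ (i, i) = (\<Sum>k\<in>{i}. ?S $$ (i, k) * T $$ (k, i))"
        unfolding prod[OF that that] using that z[of i i] by (intro sum.mono_neutral_right) auto
      then show ?thesis using Suc.IH that by simp
    qed
    ultimately show ?case by simp
  qed
  have "char_poly (A ^\<^sub>m m) = char_poly (T ^\<^sub>m m)"
    using similar_mat_wit_pow[OF sim, of m] by (intro char_poly_similar) (auto simp: similar_mat_def)
  also have "\<dots> = (\<Prod>a\<leftarrow>diag_mat (T ^\<^sub>m m). [:- a, 1:])"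
    using tri Tm T by (intro char_poly_upper_triangular[OF Tm]) auto
  also have "diag_mat (T ^\<^sub>m m) = map (\<lambda>a. a ^ m) es"
    using tri Tm T unfolding dg[symmetric] diag_mat_def by auto
  finally show ?thesis by (simp add: o_def)
qed

text \<open>
  Schur's inequality is applied to \<open>A\<^sup>m\<close> conjugated by the diagonal matrix with entries \<open>w\<close>.
  Conjugation preserves the eigenvalues but not the norm, so weights that vary strongly can suppress
  entries of a matrix far from normal that contribute to the norm but not to the spectrum.
\<close>

lemma eigenvalue_count_le_hs_norm:
  fixes A :: "complex mat"
  assumes A: "A \<in> carrier_mat n n" and r: "0 \<le> r" and w: "\<And>i. i < n \<Longrightarrow> 0 < (w i :: real)"
  shows "real (eigenvalue_count A r) * r ^ (2 * m)
    \<le> (\<Sum>i<n. \<Sum>j<n. (w j / w i * cmod ((A ^\<^sub>m m) $$ (i, j)))\<^sup>2)"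
proof -
  obtain es where es: "char_poly A = (\<Prod>a\<leftarrow>es. [:- a, 1:])"
    using char_poly_factorized[OF A] by blast
  have Am: "A ^\<^sub>m m \<in> carrier_mat n n" using A by simp
  define S where "S = mat_diag n (\<lambda>i. complex_of_real (w i))"
  define S' where "S' = mat_diag n (\<lambda>i. complex_of_real (1 / w i))"
  have SC: "S \<in> carrier_mat n n" "S' \<in> carrier_mat n n" by (auto simp: S_def S'_def)
  have "complex_of_real (1 / w i) * of_real (w i) = 1" if "i < n" for i
    using w[OF that] by simp
  then have one: "S' * S = 1\<^sub>m n" "S * S' = 1\<^sub>m n"
    unfolding S_def S'_def mat_diag_diag by (auto simp: mat_diag_def mult.commute simp del: of_real_divide intro!: eq_matI)
  define C where "C = S' * A ^\<^sub>m m * S"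
  have C: "C \<in> carrier_mat n n" using SC Am by (simp add: C_def)
  have "similar_mat_wit C (A ^\<^sub>m m) S' S"
    using SC Am C one by (intro similar_mat_witI[of _ _ n]) (auto simp: C_def)
  then have "char_poly C = (\<Prod>a\<leftarrow>map (\<lambda>a. a ^ m) es. [:- a, 1:])"
    using char_poly_similar[of C "A ^\<^sub>m m"] char_poly_pow[OF A es]
    unfolding similar_mat_def by (auto simp: o_def)
  from schur_inequality[OF C this] have le: "(\<Sum>a\<leftarrow>es. (cmod a) ^ (2 * m)) \<le> (hs_norm C)\<^sup>2"
    by (simp add: o_def norm_power power_mult[symmetric] mult.commute)
  have "real (eigenvalue_count A r) * r ^ (2 * m) = (\<Sum>a\<leftarrow>filter (\<lambda>a. r \<le> cmod a) es. r ^ (2 * m))"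
    by (simp add: eigenvalue_count_eq_length[OF A es] sum_list_triv)
  also have "\<dots> \<le> (\<Sum>a\<leftarrow>es. (cmod a) ^ (2 * m))"
    using r by (induction es) (auto intro!: add_mono power_mono intro: add_increasing)
  also note le
  also have "(hs_norm C)\<^sup>2 = (\<Sum>i<n. \<Sum>j<n. (w j / w i * cmod ((A ^\<^sub>m m) $$ (i, j)))\<^sup>2)"
  proof -
    have "C $$ (i, j) = of_real (w j / w i) * (A ^\<^sub>m m) $$ (i, j)" if "i < n" "j < n" for i j
      using that Am unfolding C_def S_def S'_def
      by (subst mat_diag_mult_right[of _ n]) (auto simp: mat_diag_mult_left[OF Am])
    then show ?thesis
      unfolding hs_norm_sq[OF C] using w by (intro sum.cong refl) (auto simp: norm_mult norm_divide power_mult_distrib power_divide)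
  qed
  finally show ?thesis .
qed

section \<open>Non-stationary phase for smooth cutoffs\<close>

definition backward_diff :: "real \<Rightarrow> (real \<Rightarrow> real) \<Rightarrow> real \<Rightarrow> real" where
  "backward_diff h f x = f x - f (x - h)"

lemma backward_diff_funpow_has_derivative:
  assumes "\<And>x. (f has_real_derivative f' x) (at x)"
  shows "((backward_diff h ^^ K) f has_real_derivative (backward_diff h ^^ K) f' x) (at x)"
proof (induction K arbitrary: x)
  case 0
  then show ?case using assms by simp
next
  case (Suc K)
  have "((\<lambda>x. (backward_diff h ^^ K) f (x - h)) has_real_derivative (backward_diff h ^^ K) f' (x - h)) (at x)"
    using DERIV_shift[of "(backward_diff h ^^ K) f" _ x "- h"] Suc.IH[of "x - h"] by simp
  from DERIV_diff[OF Suc.IH[of x] this] show ?case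
    by (simp add: backward_diff_def[abs_def])
qed

text \<open>
  The mean value theorem, once for each difference.
\<close>

lemma backward_diff_funpow_bound:
  assumes "smooth_real f" "0 \<le> h" "\<And>y. \<bar>(deriv ^^ K) f y\<bar> \<le> C"
  shows "\<bar>(backward_diff h ^^ K) f x\<bar> \<le> h ^ K * C"
  using assms
proof (induction K arbitrary: f x)
  case 0
  then show ?case by simp
next
  case (Suc K)
  have der: "(f has_real_derivative deriv f x) (at x)" for x
    using Suc.prems(1)[unfolded smooth_real_def, rule_format, of 0]
    by (auto simp: differentiable_on_def DERIV_deriv_iff_real_differentiable)
  have "smooth_real (deriv f)"
    unfolding smooth_real_def
  proof
    fix n show "(deriv ^^ n) (deriv f) differentiable_on UNIV"
      using Suc.prems(1)[unfolded smooth_real_def, rule_format, of "Suc n"]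
      by (simp add: funpow_swap1)
  qed
  then have IH: "\<bar>(backward_diff h ^^ K) (deriv f) y\<bar> \<le> h ^ K * C" for y
    using Suc.prems by (intro Suc.IH) (auto simp: funpow_swap1)
  have "\<bar>(backward_diff h ^^ K) f x - (backward_diff h ^^ K) f (x - h)\<bar> \<le> (h ^ K * C) * \<bar>x - (x - h)\<bar>"
    using field_differentiable_bound[of UNIV "(backward_diff h ^^ K) f" "(backward_diff h ^^ K) (deriv f)" "h ^ K * C" "x - h" x]
      backward_diff_funpow_has_derivative[OF der, where h = h and K = K] IH
    by simp
  then show ?case
    using Suc.prems(2) by (simp add: backward_diff_def[of h "(backward_diff h ^^ K) f"] mult_ac)
qed

lemma backward_diff_funpow_support:
  assumes "\<And>x. x < 0 \<or> b \<le> x \<Longrightarrow> f x = 0" "0 \<le> h" "x < 0 \<or> b + real K * h \<le> x"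
  shows "(backward_diff h ^^ K) f x = 0"
  using assms(3)
proof (induction K arbitrary: x)
  case 0
  then show ?case using assms by simp
next
  case (Suc K)
  have "(backward_diff h ^^ K) f x = 0" "(backward_diff h ^^ K) f (x - h) = 0"
    using Suc.prems assms(2) by (auto intro!: Suc.IH simp: algebra_simps)
  then show ?case by (simp add: backward_diff_def[of h "(backward_diff h ^^ K) f"])
qed

lemma summation_by_parts:
  fixes z :: complex
  assumes "f (- h) = 0" "f (real R * h) = 0"
  shows "(1 - z) * (\<Sum>m<Suc R. of_real (f (real m * h)) * z ^ m)
    = (\<Sum>m<Suc R. of_real (backward_diff h f (real m * h)) * z ^ m)"
proof -
  have "(\<Sum>m<Suc R. of_real (f (real m * h - h)) * z ^ m)
      = (\<Sum>m<R. of_real (f (real m * h)) * z ^ Suc m)"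
    using assms(1) by (subst sum.lessThan_Suc_shift) (simp add: algebra_simps)
  also have "\<dots> = z * (\<Sum>m<Suc R. of_real (f (real m * h)) * z ^ m)"
    using assms(2) by (simp add: sum_distrib_left mult_ac)
  finally show ?thesis
    by (simp add: backward_diff_def left_diff_distrib sum_subtractf del: sum.lessThan_Suc)
qed

text \<open>
  Each difference enlarges the support by one step to the right, so the range of summation is
  lengthened by one each time and all boundary terms vanish.
\<close>

lemma summation_by_parts_iterated:
  fixes z :: complex
  assumes "\<And>x. x < 0 \<or> real n * h \<le> x \<Longrightarrow> f x = 0" "0 < h"
  shows "(1 - z) ^ K * (\<Sum>m<n. of_real (f (real m * h)) * z ^ m)
    = (\<Sum>m<n + K. of_real ((backward_diff h ^^ K) f (real m * h)) * z ^ m)"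
proof (induction K)
  case 0
  then show ?case by simp
next
  case (Suc K)
  let ?g = "(backward_diff h ^^ K) f"
  have zero: "?g (- h) = 0" "?g (real (n + K) * h) = 0"
    using assms by (auto intro!: backward_diff_funpow_support[where b = "real n * h"] simp: algebra_simps)
  have "(1 - z) ^ Suc K * (\<Sum>m<n. of_real (f (real m * h)) * z ^ m)
      = (1 - z) * (\<Sum>m<Suc (n + K). of_real (?g (real m * h)) * z ^ m)"
    using Suc.IH zero(2) by (simp add: mult.assoc)
  also have "\<dots> = (\<Sum>m<Suc (n + K). of_real (backward_diff h ?g (real m * h)) * z ^ m)"
    by (rule summation_by_parts) (use zero in auto)
  finally show ?case by simp
qed

text \<open>
  The positive distance of the support to both end points is what later keeps the phase away
  from the neighbouring periods.
\<close>

lemma cutoff_support: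
  assumes "cutoff chi"
  obtains c where "0 < c" "c < 1" "\<And>x. chi x \<noteq> 0 \<Longrightarrow> c \<le> x \<and> x \<le> 1 - c"
proof (cases "{x. chi x \<noteq> 0} = {}")
  case True
  then show ?thesis by (intro that[of "1/2"]) auto
next
  case False
  let ?S = "closure {x. chi x \<noteq> 0}"
  have S: "compact ?S" "?S \<noteq> {}" "?S \<subseteq> {0<..<1}"
    using assms False unfolding cutoff_def by (auto simp: closure_eq_empty)
  obtain a where a: "a \<in> ?S" "\<And>x. x \<in> ?S \<Longrightarrow> a \<le> x"
    using compact_attains_inf[OF S(1,2)] by blast
  obtain b where b: "b \<in> ?S" "\<And>x. x \<in> ?S \<Longrightarrow> x \<le> b"
    using compact_attains_sup[OF S(1,2)] by blast
  have in_S: "x \<in> ?S" if "chi x \<noteq> 0" for x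
    using that closure_subset by fastforce
  show ?thesis
    using a b S(3) in_S by (intro that[of "min a (1 - b)"]) force+
qed

lemma deriv_funpow_zero_on_open:
  fixes f :: "real \<Rightarrow> real"
  assumes "open S" "\<And>x. x \<in> S \<Longrightarrow> f x = 0" "x \<in> S"
  shows "(deriv ^^ K) f x = 0"
  using assms(3)
proof (induction K arbitrary: x)
  case 0
  then show ?case using assms by simp
next
  case (Suc K)
  have "((deriv ^^ K) f has_real_derivative 0) (at x)"
    by (rule has_field_derivative_transform_within_open[of "\<lambda>_. 0" _ _ S])
      (use Suc assms(1) in auto)
  then show ?case by (simp add: DERIV_imp_deriv)
qed

lemma cutoff_deriv_bounded:
  assumes "cutoff chi"
  obtains C where "0 \<le> C" "\<And>x. \<bar>(deriv ^^ K) chi x\<bar> \<le> C"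
proof -
  obtain c where c: "0 < c" "\<And>x. chi x \<noteq> 0 \<Longrightarrow> c \<le> x \<and> x \<le> 1 - c"
    using cutoff_support[OF assms] by metis
  let ?g = "(deriv ^^ K) chi"
  have "continuous_on {0..1} ?g"
    using assms unfolding cutoff_def smooth_real_def
    by (meson continuous_on_subset differentiable_imp_continuous_on subset_UNIV)
  then have "bounded (?g ` {0..1})"
    by (intro compact_imp_bounded compact_continuous_image) auto
  then obtain C where C: "\<And>x. x \<in> {0..1} \<Longrightarrow> \<bar>?g x\<bar> \<le> C"
    unfolding bounded_iff by (metis imageI real_norm_def)
  have "?g x = 0" if "x \<notin> {0..1}" for x
    by (rule deriv_funpow_zero_on_open[of "- {0..1}"]) (use that c in \<open>auto simp: open_Compl\<close>, fastforce+)
  then have "\<bar>?g x\<bar> \<le> \<bar>C\<bar>" for x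
    using C[of x] by (cases "x \<in> {0..1}") auto
  then show ?thesis by (intro that[of "\<bar>C\<bar>"]) auto
qed

text \<open>
  Non-stationary phase for sums: since the \<open>K\<close>-th difference of a smooth function with step
  \<open>1 / n\<close> is of size \<open>n\<^sup>-\<^sup>K\<close>, every summation by parts gains a factor of order
  \<open>1 / (n \<bar>1 - z\<bar>)\<close>.
\<close>

lemma cutoff_exponential_sum:
  assumes "cutoff chi"
  obtains C where "0 \<le> C"
    "\<And>n z. 1 \<le> n \<Longrightarrow> cmod z = 1 \<Longrightarrow>
       cmod (1 - z) ^ K * cmod (\<Sum>m<n. of_real (chi (real m / real n)) * z ^ m) \<le> C * real n / real n ^ K"
proof -
  obtain C where C: "0 \<le> C" "\<And>x. \<bar>(deriv ^^ K) chi x\<bar> \<le> C"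
    using cutoff_deriv_bounded[OF assms] by metis
  obtain c where c: "0 < c" "\<And>x. chi x \<noteq> 0 \<Longrightarrow> c \<le> x \<and> x \<le> 1 - c"
    using cutoff_support[OF assms] by metis
  show ?thesis
  proof (rule that[of "(1 + real K) * C"])
    show "0 \<le> (1 + real K) * C" using C by simp
    fix n :: nat and z :: complex assume n: "1 \<le> n" and z: "cmod z = 1"
    define h where "h = 1 / real n"
    have h: "0 < h" "real n * h = 1" using n by (auto simp: h_def)
    have "chi x = 0" if "x < 0 \<or> real n * h \<le> x" for x
      using c(1) c(2)[of x] that h(2) by force
    from summation_by_parts_iterated[where f = chi and n = n and h = h and z = z and K = K, OF this h(1)]
    have "(1 - z) ^ K * (\<Sum>m<n. of_real (chi (real m / real n)) * z ^ m)
        = (\<Sum>m<n + K. of_real ((backward_diff h ^^ K) chi (real m * h)) * z ^ m)"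
      by (simp add: h_def)
    then have "cmod (1 - z) ^ K * cmod (\<Sum>m<n. of_real (chi (real m / real n)) * z ^ m)
        = cmod (\<Sum>m<n + K. of_real ((backward_diff h ^^ K) chi (real m * h)) * z ^ m)"
      unfolding norm_mult[symmetric] norm_power[symmetric] by (rule arg_cong)
    also have "\<dots> \<le> (\<Sum>m<n + K. h ^ K * C)"
    proof (rule sum_norm_le)
      fix m
      show "cmod (of_real ((backward_diff h ^^ K) chi (real m * h)) * z ^ m) \<le> h ^ K * C"
        using backward_diff_funpow_bound[of chi h K C "real m * h"] assms C h z
        by (simp add: cutoff_def norm_mult norm_power)
    qed
    also have "\<dots> = (real n + real K) * (C / real n ^ K)"
      by (simp add: h_def power_divide)
    also have "\<dots> \<le> ((1 + real K) * real n) * (C / real n ^ K)"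
      using n C mult_right_mono[of 1 "real n" "real K"] by (intro mult_right_mono) (auto simp: algebra_simps)
    finally show "cmod (1 - z) ^ K * cmod (\<Sum>m<n. of_real (chi (real m / real n)) * z ^ m)
        \<le> (1 + real K) * C * real n / real n ^ K"
      by (simp add: mult_ac)
  qed
qed

text \<open>
  By concavity the sine lies above its chord from \<open>0\<close> to \<open>\<pi> (1 - c)\<close>.
\<close>

lemma sin_lower_bound:
  assumes "0 < c" "c < 1" "0 \<le> x" "x \<le> 1 - c"
  shows "sin (pi * c) * x \<le> sin (pi * x)"
proof -
  have conv: "convex_on {0..pi} (\<lambda>x. - sin x)"
    by (rule f''_ge0_imp_convex[where f' = "\<lambda>x. - cos x" and f'' = sin])
      (auto intro!: derivative_eq_intros sin_ge_zero)
  define u where "u = x / (1 - c)"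
  have u: "0 \<le> u" "u \<le> 1" "pi * x = u * (pi * (1 - c))"
    using assms by (auto simp: u_def)
  have "- sin ((1 - u) *\<^sub>R 0 + u *\<^sub>R (pi * (1 - c))) \<le> (1 - u) * (- sin 0) + u * (- sin (pi * (1 - c)))"
    using convex_onD[OF conv, of u 0 "pi * (1 - c)"] u assms by simp
  then have "u * sin (pi * (1 - c)) \<le> sin (pi * x)"
    unfolding u(3) by simp
  moreover have "sin (pi * (1 - c)) = sin (pi * c)"
    by (simp add: right_diff_distrib)
  moreover have "x \<le> u"
    using assms by (simp add: u_def field_simps mult_left_le)
  moreover have "0 \<le> sin (pi * c)"
    using assms by (intro sin_ge_zero) (auto simp: mult_left_le)
  ultimately show ?thesis
    using mult_right_mono[of x u "sin (pi * c)"] by (simp add: mult.commute)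
qed

text \<open>
  The right-hand side also vanishes at \<open>t = 1\<close> and \<open>t = -1\<close>; the last hypothesis keeps \<open>t\<close> at
  distance \<open>c\<close> from these points.
\<close>

lemma one_minus_exp_lower_bound:
  assumes "0 < c" "c < 1" "\<bar>t\<bar> \<le> 1 - c"
  shows "2 * sin (pi * c) * \<bar>t\<bar> \<le> cmod (1 - exp (\<i> * of_real (2 * pi * t)))"
proof -
  have "sin (pi * c) * \<bar>t\<bar> \<le> \<bar>sin (pi * t)\<bar>"
    using sin_lower_bound[OF assms(1,2), of "\<bar>t\<bar>"] assms(3) by (cases "0 \<le> t") auto
  then show ?thesis
    using dist_exp_i_1[of "2 * pi * t"] by (simp add: norm_minus_commute mult_ac)
qed

section \<open>The matrix of the baker's map\<close>

lemma index_mult_mat_sum: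
  assumes "A \<in> carrier_mat n m" "B \<in> carrier_mat m p" "i < n" "j < p"
  shows "(A * B) $$ (i, j) = (\<Sum>l<m. A $$ (i, l) * B $$ (l, j))"
  using assms by (simp add: scalar_prod_def lessThan_atLeast0)

lemma fourier_mat_carrier [simp]: "fourier_mat N \<in> carrier_mat N N"
  by (simp add: fourier_mat_def)

lemma fourier_mat_dim [simp]: "dim_row (fourier_mat N) = N" "dim_col (fourier_mat N) = N"
  by (simp_all add: fourier_mat_def)

lemma fourier_mat_index:
  assumes "i < N" "j < N"
  shows "fourier_mat N $$ (i, j) = exp (\<i> * of_real (2 * pi * (- (real i * real j / real N)))) / of_real (sqrt (real N))"
  using assms by (simp add: fourier_mat_def mult_ac)

text \<open>
  The products of entries form a geometric progression whose ratio is an \<open>N\<close>-th root of unity.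
\<close>

lemma fourier_orthogonality:
  assumes "i < N" "j < N"
  shows "(\<Sum>l<N. cnj (fourier_mat N $$ (l, i)) * fourier_mat N $$ (l, j)) = (if i = j then 1 else 0)"
proof -
  have N: "0 < N" using assms by simp
  define z where "z = exp (\<i> * of_real (2 * pi * ((real i - real j) / real N)))"
  have summand: "cnj (fourier_mat N $$ (l, i)) * fourier_mat N $$ (l, j) = z ^ l / of_nat N" if "l < N" for l
  proof -
    have "cnj (fourier_mat N $$ (l, i)) * fourier_mat N $$ (l, j)
        = exp (\<i> * of_real (2 * pi * (real l * real i / real N))) * exp (\<i> * of_real (2 * pi * (- (real l * real j / real N))))
          / (of_real (sqrt (real N)) * of_real (sqrt (real N)))"
      using assms that by (simp add: fourier_mat_index exp_cnj)
    also have "of_real (sqrt (real N)) * of_real (sqrt (real N)) = (of_nat N :: complex)"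
      by (simp flip: of_real_mult)
    also have "exp (\<i> * of_real (2 * pi * (real l * real i / real N))) * exp (\<i> * of_real (2 * pi * (- (real l * real j / real N)))) = z ^ l"
      unfolding z_def exp_of_nat_mult[symmetric] exp_add[symmetric]
      by (rule arg_cong[where f = exp]) (simp add: algebra_simps diff_divide_distrib)
    finally show ?thesis .
  qed
  have "(\<Sum>l<N. cnj (fourier_mat N $$ (l, i)) * fourier_mat N $$ (l, j)) = (\<Sum>l<N. z ^ l) / of_nat N"
    by (simp add: summand sum_divide_distrib)
  also have "\<dots> = (if i = j then 1 else 0)"
  proof (cases "i = j")
    case True
    then show ?thesis using N by (simp add: z_def)
  next
    case False
    have "z ^ N = exp (complex_of_real (2 * of_int (int i - int j) * pi) * \<i>)"
      unfolding z_def exp_of_nat_mult[symmetric] using N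
      by (intro arg_cong[where f = exp]) (simp add: field_simps)
    then have zN: "z ^ N = 1"
      using exp_integer_2pi[OF Ints_of_int, of "int i - int j"] by simp
    have "z \<noteq> 1"
    proof
      assume "z = 1"
      then obtain k :: int where "2 * pi * ((real i - real j) / real N) = of_int (2 * k) * pi"
        unfolding z_def exp_eq_1 by auto
      then have "(2 * pi) * ((real i - real j) / real N) = (2 * pi) * of_int k"
        by (simp add: mult_ac)
      then have "(real i - real j) / real N = of_int k"
        unfolding mult_cancel_left by simp
      then have "real i - real j = of_int k * real N"
        using N by (simp add: field_simps)
      then have k: "int i - int j = k * int N"
        by (metis of_int_diff of_int_eq_iff of_int_mult of_int_of_nat_eq)
      then have "k \<noteq> 0" using False by auto
      then have "1 * int N \<le> \<bar>k\<bar> * int N"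
        by (intro mult_right_mono) auto
      then have "int N \<le> \<bar>int i - int j\<bar>"
        by (simp add: k abs_mult)
      then show False using assms by linarith
    qed
    then have "(\<Sum>l<N. z ^ l) = 0"
      using zN by (simp add: geometric_sum)
    then show ?thesis using False by simp
  qed
  finally show ?thesis .
qed

lemma fourier_mat_unitary:
  "mat_adjoint (fourier_mat N) * fourier_mat N = 1\<^sub>m N"
  "fourier_mat N * mat_adjoint (fourier_mat N) = 1\<^sub>m N"
proof -
  show 1: "mat_adjoint (fourier_mat N) * fourier_mat N = 1\<^sub>m N"
    by (rule eq_matI) (simp_all add: scalar_prod_def lessThan_atLeast0[symmetric] fourier_orthogonality)
  show "fourier_mat N * mat_adjoint (fourier_mat N) = 1\<^sub>m N"
    by (rule mat_mult_left_right_inverse[OF _ _ 1]) auto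
qed

lemma block_index_less:
  fixes b M n t :: nat
  assumes "b < M" "t < n"
  shows "b * n + t < M * n"
proof -
  have "b * n + t < Suc b * n" using assms(2) by simp
  also have "\<dots> \<le> M * n" using assms(1) by (intro mult_right_mono) auto
  finally show ?thesis .
qed

text \<open>
  The tensor product of the identity on \<open>\<complex>\<^sup>M\<close> with the Fourier transform of size \<open>n\<close>: one
  transform on each of the \<open>M\<close> consecutive blocks of length \<open>n\<close>.
\<close>

definition block_fourier :: "nat \<Rightarrow> nat \<Rightarrow> complex mat" where
  "block_fourier M n = Matrix.mat (M * n) (M * n)
     (\<lambda>(i, j). if i div n = j div n then fourier_mat n $$ (i mod n, j mod n) else 0)"

definition block_cutoff :: "nat \<Rightarrow> nat set \<Rightarrow> (real \<Rightarrow> real) \<Rightarrow> nat \<Rightarrow> complex mat" where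
  "block_cutoff M \<A> chi n = mat_diag (M * n)
     (\<lambda>j. if j div n \<in> \<A> then of_real (chi (real (j mod n) / real n)) else 0)"

lemma block_fourier_carrier [simp]: "block_fourier M n \<in> carrier_mat (M * n) (M * n)"
  by (simp add: block_fourier_def)

lemma block_fourier_dim [simp]: "dim_row (block_fourier M n) = M * n" "dim_col (block_fourier M n) = M * n"
  by (simp_all add: block_fourier_def)

lemma block_cutoff_carrier [simp]: "block_cutoff M \<A> chi n \<in> carrier_mat (M * n) (M * n)"
  by (simp add: block_cutoff_def)

lemma sum_block:
  fixes f :: "nat \<Rightarrow> 'a :: comm_monoid_add"
  assumes "b < M" "\<And>l. l < M * n \<Longrightarrow> l div n \<noteq> b \<Longrightarrow> f l = 0"
  shows "(\<Sum>l<M * n. f l) = (\<Sum>t<n. f (b * n + t))"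
proof -
  have "(\<lambda>t. b * n + t) ` {..<n} \<subseteq> {..<M * n}"
    using block_index_less[OF assms(1)] by auto
  moreover have "f l = 0" if "l \<in> {..<M * n} - (\<lambda>t. b * n + t) ` {..<n}" for l
  proof (rule assms(2))
    show "l div n \<noteq> b"
    proof
      assume l: "l div n = b"
      have "0 < n" using that by (cases n) auto
      then have "l mod n < n" by simp
      moreover have "l = b * n + l mod n" using l by (metis div_mult_mod_eq)
      ultimately have "l \<in> (\<lambda>t. b * n + t) ` {..<n}" by blast
      then show False using that by simp
    qed
  qed (use that in auto)
  ultimately have "(\<Sum>l<M * n. f l) = sum f ((\<lambda>t. b * n + t) ` {..<n})"
    by (intro sum.mono_neutral_right) auto
  also have "\<dots> = (\<Sum>t<n. f (b * n + t))"
    by (subst sum.reindex) (auto simp: inj_on_def)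
  finally show ?thesis .
qed

lemma block_fourier_unitary:
  "mat_adjoint (block_fourier M n) * block_fourier M n = 1\<^sub>m (M * n)"
  "block_fourier M n * mat_adjoint (block_fourier M n) = 1\<^sub>m (M * n)"
proof -
  let ?F = "block_fourier M n"
  show 1: "mat_adjoint ?F * ?F = 1\<^sub>m (M * n)"
  proof (rule eq_matI)
    fix i j assume "i < dim_row (1\<^sub>m (M * n) :: complex mat)" "j < dim_col (1\<^sub>m (M * n) :: complex mat)"
    then have ij: "i < M * n" "j < M * n" by auto
    then have n: "0 < n" by (cases n) auto
    have b: "i div n < M" using ij by (simp add: less_mult_imp_div_less)
    have bnd: "i div n * n + t < M * n" if "t < n" for t
      using b that by (rule block_index_less)
    have "(mat_adjoint ?F * ?F) $$ (i, j) = (\<Sum>l<M * n. cnj (?F $$ (l, i)) * ?F $$ (l, j))"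
      using ij by (simp add: scalar_prod_def lessThan_atLeast0)
    also have "\<dots> = (\<Sum>t<n. cnj (?F $$ (i div n * n + t, i)) * ?F $$ (i div n * n + t, j))"
      by (rule sum_block[OF b]) (use ij in \<open>auto simp: block_fourier_def\<close>)
    also have "\<dots> = (\<Sum>t<n. if j div n = i div n then cnj (fourier_mat n $$ (t, i mod n)) * fourier_mat n $$ (t, j mod n) else 0)"
      using ij bnd by (intro sum.cong) (auto simp: block_fourier_def)
    also have "\<dots> = (if j div n = i div n \<and> i mod n = j mod n then 1 else 0)"
      using n by (cases "j div n = i div n") (auto simp: fourier_orthogonality)
    also have "\<dots> = (if i = j then 1 else 0)"
    proof -
      have "i = j" if "j div n = i div n" "i mod n = j mod n"
        using that by (metis div_mult_mod_eq)
      then show ?thesis by auto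
    qed
    finally show "(mat_adjoint ?F * ?F) $$ (i, j) = 1\<^sub>m (M * n) $$ (i, j)"
      using ij by simp
  qed auto
  show "?F * mat_adjoint ?F = 1\<^sub>m (M * n)"
    by (rule mat_mult_left_right_inverse[OF _ _ 1]) auto
qed

text \<open>
  The sum over the alphabet of the operators \<open>\<Pi>\<^sub>a\<^sup>* \<chi> F \<chi> \<Pi>\<^sub>a\<close>. Working with square matrices
  of the full size, rather than with the rectangular projections, makes it a product of contractions.
\<close>

definition symbol_mat :: "nat \<Rightarrow> nat set \<Rightarrow> (real \<Rightarrow> real) \<Rightarrow> nat \<Rightarrow> complex mat" where
  "symbol_mat M \<A> chi n = block_cutoff M \<A> chi n * block_fourier M n * block_cutoff M \<A> chi n"

lemma symbol_mat_carrier [simp]: "symbol_mat M \<A> chi n \<in> carrier_mat (M * n) (M * n)"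
  unfolding symbol_mat_def by (intro mult_carrier_mat[of _ "M * n" "M * n"]) simp_all

lemma symbol_mat_dim [simp]:
  "dim_row (symbol_mat M \<A> chi n) = M * n" "dim_col (symbol_mat M \<A> chi n) = M * n"
  using symbol_mat_carrier[of M \<A> chi n] by (simp_all del: symbol_mat_carrier)

lemma symbol_mat_index:
  assumes "i < M * n" "j < M * n"
  shows "symbol_mat M \<A> chi n $$ (i, j) =
    (if i div n \<in> \<A> \<and> j div n = i div n then
       of_real (chi (real (i mod n) / real n)) * fourier_mat n $$ (i mod n, j mod n)
         * of_real (chi (real (j mod n) / real n)) else 0)"
  unfolding symbol_mat_def block_cutoff_def
  by (subst mat_diag_mult_right[of _ "M * n"])
    (use assms in \<open>auto simp: mat_diag_mult_left[of _ "M * n" "M * n"] block_fourier_def\<close>)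

text \<open>
  This symmetry is the reason why position and frequency play the same role for the baker's map.
\<close>

lemma symbol_mat_transpose: "transpose_mat (symbol_mat M \<A> chi n) = symbol_mat M \<A> chi n"
proof (rule eq_matI)
  fix i j assume "i < dim_row (symbol_mat M \<A> chi n)" "j < dim_col (symbol_mat M \<A> chi n)"
  then have ij: "i < M * n" "j < M * n" using symbol_mat_carrier[of M \<A> chi n] by auto
  then have "0 < n" by (cases n) auto
  then have "fourier_mat n $$ (j mod n, i mod n) = fourier_mat n $$ (i mod n, j mod n)"
    by (simp add: fourier_mat_index mult.commute)
  then show "transpose_mat (symbol_mat M \<A> chi n) $$ (i, j) = symbol_mat M \<A> chi n $$ (i, j)"
    using ij symbol_mat_carrier[of M \<A> chi n] by (auto simp: symbol_mat_index)
qed (use symbol_mat_carrier[of M \<A> chi n] in auto)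

lemma baker_summand_index:
  fixes X :: "complex mat"
  assumes X: "X \<in> carrier_mat n n" and ij: "i < M * n" "j < M * n" and M: "0 < M"
  shows "(mat_adjoint (proj_mat M (M * n) a) * X * proj_mat M (M * n) a) $$ (i, j)
    = (if i div n = a \<and> j div n = a then X $$ (i mod n, j mod n) else 0)"
proof -
  have n: "0 < n" using ij by (cases n) auto
  define P where "P = proj_mat M (M * n) a"
  have P: "P \<in> carrier_mat n (M * n)" using M by (simp add: P_def proj_mat_def)
  have Pe: "P $$ (s, l) = (if l div n = a \<and> s = l mod n then 1 else 0)" if "s < n" "l < M * n" for s l
  proof -
    have "l = s + a * n \<longleftrightarrow> l div n = a \<and> s = l mod n"
    proof
      assume "l div n = a \<and> s = l mod n"
      then show "l = s + a * n" using div_mult_mod_eq[of l n] by (simp add: add.commute)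
    qed (use that n in simp)
    then show ?thesis using that M by (simp add: P_def proj_mat_def)
  qed
  have XP: "(X * P) $$ (s, j) = (if j div n = a then X $$ (s, j mod n) else 0)" if "s < n" for s
  proof -
    have "(X * P) $$ (s, j) = (\<Sum>t<n. X $$ (s, t) * P $$ (t, j))"
      using that X P ij by (simp add: scalar_prod_def lessThan_atLeast0)
    also have "\<dots> = (\<Sum>t<n. if t = j mod n then (if j div n = a then X $$ (s, j mod n) else 0) else 0)"
      using ij by (intro sum.cong) (auto simp: Pe)
    finally show ?thesis using n by simp
  qed
  have "(mat_adjoint P * X * P) $$ (i, j) = (mat_adjoint P * (X * P)) $$ (i, j)"
    using X P by (simp add: assoc_mult_mat[of _ "M * n" n _ n _ "M * n"])
  also have "\<dots> = (\<Sum>s<n. cnj (P $$ (s, i)) * (X * P) $$ (s, j))"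
    using X P ij by (simp add: scalar_prod_def lessThan_atLeast0)
  also have "\<dots> = (\<Sum>s<n. if s = i mod n then (if i div n = a \<and> j div n = a then X $$ (i mod n, j mod n) else 0) else 0)"
    using ij by (intro sum.cong) (auto simp: Pe XP)
  finally show ?thesis using n by (simp add: P_def)
qed

text \<open>
  The Fourier transform of full size is common to all summands of the baker's map. What remains
  is block diagonal and symmetric.
\<close>

lemma baker_mat_factorization:
  assumes A: "\<A> \<subseteq> {0..<M}" and n: "0 < n" and M: "0 < M"
  shows "baker_mat M \<A> chi (M * n) = mat_adjoint (fourier_mat (M * n)) * symbol_mat M \<A> chi n"
proof (rule eq_matI)
  let ?N = "M * n" and ?G = "symbol_mat M \<A> chi n"
  note G = symbol_mat_carrier[of M \<A> chi n]
  fix i j assume "i < dim_row (mat_adjoint (fourier_mat ?N) * ?G)" "j < dim_col (mat_adjoint (fourier_mat ?N) * ?G)"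
  then have ij: "i < ?N" "j < ?N" using G by auto
  let ?F = "mat_adjoint (fourier_mat ?N)"
  define X where "X = cutoff_mat chi n * fourier_mat n * cutoff_mat chi n"
  have X: "X \<in> carrier_mat n n"
    unfolding X_def cutoff_mat_def by (intro mult_carrier_mat[of _ n n]) simp_all
  have Xe: "X $$ (s, t) = of_real (chi (real s / real n)) * fourier_mat n $$ (s, t) * of_real (chi (real t / real n))"
    if "s < n" "t < n" for s t
    unfolding X_def cutoff_mat_def
    by (subst mat_diag_mult_right[of _ n])
      (use that in \<open>auto simp: mat_diag_mult_left[of _ n n]\<close>)
  have P: "proj_mat M ?N a \<in> carrier_mat n ?N" for a using M by (simp add: proj_mat_def)
  have C: "cutoff_mat chi n \<in> carrier_mat n n" by (simp add: cutoff_mat_def)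
  have assoc: "?F * mat_adjoint (proj_mat M ?N a) * cutoff_mat chi (?N div M) * fourier_mat (?N div M) * cutoff_mat chi (?N div M) * proj_mat M ?N a
      = ?F * (mat_adjoint (proj_mat M ?N a) * X * proj_mat M ?N a)" for a
  proof -
    define P' where "P' = mat_adjoint (proj_mat M ?N a)"
    have P': "P' \<in> carrier_mat ?N n" using P by (simp add: P'_def)
    have F: "?F \<in> carrier_mat ?N ?N" by simp
    have "?N div M = n" using M by simp
    moreover have "?F * P' * cutoff_mat chi n * fourier_mat n * cutoff_mat chi n * proj_mat M ?N a
        = ?F * P' * (cutoff_mat chi n * fourier_mat n * cutoff_mat chi n) * proj_mat M ?N a"
    proof -
      define FP where "FP = ?F * P'"
      have FP: "FP \<in> carrier_mat ?N n" unfolding FP_def using F P' by (rule mult_carrier_mat)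
      have CF: "cutoff_mat chi n * fourier_mat n \<in> carrier_mat n n"
        using C by (rule mult_carrier_mat) simp
      show ?thesis
        unfolding FP_def[symmetric] assoc_mult_mat[OF FP C fourier_mat_carrier] assoc_mult_mat[OF FP CF C] ..
    qed
    moreover have "\<dots> = ?F * (P' * X * proj_mat M ?N a)"
      unfolding X_def[symmetric] assoc_mult_mat[OF F P' X]
      by (rule assoc_mult_mat[OF F mult_carrier_mat[OF P' X] P])
    ultimately show ?thesis by (simp add: P'_def)
  qed
  have "baker_mat M \<A> chi ?N $$ (i, j)
      = (\<Sum>a\<in>\<A>. (?F * (mat_adjoint (proj_mat M ?N a) * X * proj_mat M ?N a)) $$ (i, j))"
    unfolding baker_mat_def assoc using ij by simp
  also have "\<dots> = (\<Sum>a\<in>\<A>. \<Sum>l<?N. ?F $$ (i, l) * (if l div n = a \<and> j div n = a then X $$ (l mod n, j mod n) else 0))"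
  proof (intro sum.cong refl)
    fix a
    let ?Y = "mat_adjoint (proj_mat M ?N a) * X * proj_mat M ?N a"
    have Y: "?Y \<in> carrier_mat ?N ?N" using X P[of a] by (metis mat_adjoint_carrier mult_carrier_mat)
    have "(?F * ?Y) $$ (i, j) = (\<Sum>l<?N. ?F $$ (i, l) * ?Y $$ (l, j))"
      using ij by (intro index_mult_mat_sum[OF _ Y]) simp_all
    then show "(?F * ?Y) $$ (i, j) = (\<Sum>l<?N. ?F $$ (i, l) * (if l div n = a \<and> j div n = a then X $$ (l mod n, j mod n) else 0))"
      using ij by (simp add: baker_summand_index[OF X _ _ M] del: index_mat_adjoint)
  qed
  also have "\<dots> = (\<Sum>l<?N. \<Sum>a\<in>\<A>. ?F $$ (i, l) * (if l div n = a \<and> j div n = a then X $$ (l mod n, j mod n) else 0))"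
    by (rule sum.swap)
  also have "\<dots> = (\<Sum>l<?N. ?F $$ (i, l) * ?G $$ (l, j))"
  proof (intro sum.cong refl)
    fix l assume "l \<in> {..<?N}"
    then have l: "l < ?N" by simp
    have fin: "finite \<A>" using A finite_subset by blast
    have "(\<Sum>a\<in>\<A>. ?F $$ (i, l) * (if l div n = a \<and> j div n = a then X $$ (l mod n, j mod n) else 0))
       = (\<Sum>a\<in>\<A>. if l div n = a then ?F $$ (i, l) * (if j div n = l div n then X $$ (l mod n, j mod n) else 0) else 0)"
      by (intro sum.cong) auto
    also have "\<dots> = (if l div n \<in> \<A> then ?F $$ (i, l) * (if j div n = l div n then X $$ (l mod n, j mod n) else 0) else 0)"
      using fin by (simp add: sum.delta)
    also have "\<dots> = ?F $$ (i, l) * ?G $$ (l, j)"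
      using l ij n by (simp add: symbol_mat_index Xe)
    finally show "(\<Sum>a\<in>\<A>. ?F $$ (i, l) * (if l div n = a \<and> j div n = a then X $$ (l mod n, j mod n) else 0)) = ?F $$ (i, l) * ?G $$ (l, j)" .
  qed
  also have "\<dots> = (?F * ?G) $$ (i, j)"
    using G ij by (simp add: scalar_prod_def lessThan_atLeast0)
  finally show "baker_mat M \<A> chi ?N $$ (i, j) = (?F * ?G) $$ (i, j)" .
qed (use symbol_mat_carrier[of M \<A> chi n] in \<open>auto simp: baker_mat_def\<close>)

lemma baker_mat_carrier [simp]: "baker_mat M \<A> chi N \<in> carrier_mat N N"
  by (simp add: baker_mat_def)

lemma baker_mat_index:
  assumes A: "\<A> \<subseteq> {0..<M}" and n: "0 < n" and ij: "i < M * n" "j < M * n"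
  shows "baker_mat M \<A> chi (M * n) $$ (i, j) =
    (\<Sum>t<n. cnj (fourier_mat (M * n) $$ (j div n * n + t, i)) * symbol_mat M \<A> chi n $$ (j div n * n + t, j))"
proof -
  have M: "0 < M" using ij by (cases M) auto
  have b: "j div n < M" using ij by (simp add: less_mult_imp_div_less)
  have bnd: "j div n * n + t < M * n" if "t < n" for t
    using b that by (rule block_index_less)
  have "baker_mat M \<A> chi (M * n) $$ (i, j)
      = (\<Sum>l<M * n. mat_adjoint (fourier_mat (M * n)) $$ (i, l) * symbol_mat M \<A> chi n $$ (l, j))"
    unfolding baker_mat_factorization[OF A n M] using ij
    by (intro index_mult_mat_sum) simp_all
  also have "\<dots> = (\<Sum>t<n. mat_adjoint (fourier_mat (M * n)) $$ (i, j div n * n + t) * symbol_mat M \<A> chi n $$ (j div n * n + t, j))"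
    by (rule sum_block[OF b]) (use ij in \<open>simp add: symbol_mat_index\<close>)
  also have "\<dots> = (\<Sum>t<n. cnj (fourier_mat (M * n) $$ (j div n * n + t, i)) * symbol_mat M \<A> chi n $$ (j div n * n + t, j))"
    using ij bnd by (intro sum.cong) simp_all
  finally show ?thesis .
qed

lemma baker_mat_outside:
  assumes "\<A> \<subseteq> {0..<M}" "i < M * n" "j < M * n" "j div n \<notin> \<A>"
  shows "baker_mat M \<A> chi (M * n) $$ (i, j) = 0"
proof -
  have n: "0 < n" using assms by (cases n) auto
  have b: "j div n < M" using assms by (simp add: less_mult_imp_div_less)
  have bnd: "j div n * n + t < M * n" if "t < n" for t
    using b that by (rule block_index_less)
  show ?thesis
    unfolding baker_mat_index[OF assms(1) n assms(2,3)]
    using assms bnd by (intro sum.neutral) (simp add: symbol_mat_index)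
qed

text \<open>
  The exponentials of the two Fourier matrices combine to \<open>z\<^sup>t\<close> times a factor of modulus one
  that does not depend on \<open>t\<close>.
\<close>

lemma norm_baker_mat_index:
  assumes A: "\<A> \<subseteq> {0..<M}" and ij: "i < M * n" "j < M * n" and b: "j div n \<in> \<A>"
  defines "z \<equiv> exp (\<i> * of_real (2 * pi * ((real i - real M * real (j mod n)) / real (M * n))))"
  shows "cmod (baker_mat M \<A> chi (M * n) $$ (i, j)) =
    \<bar>chi (real (j mod n) / real n)\<bar> / (sqrt (real (M * n)) * sqrt (real n))
      * cmod (\<Sum>t<n. of_real (chi (real t / real n)) * z ^ t)"
proof -
  have n: "0 < n" using ij by (cases n) auto
  have M: "0 < M" using ij by (cases M) auto
  define b where "b = j div n"
  define j' where "j' = j mod n"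
  have bM: "b < M" using ij by (simp add: less_mult_imp_div_less b_def)
  have bnd: "b * n + t < M * n" if "t < n" for t
    using bM that by (rule block_index_less)
  define p where "p = exp (\<i> * of_real (2 * pi * (real (b * n) * real i / real (M * n))))"
  define c where "c = of_real (chi (real j' / real n)) * p / (of_real (sqrt (real (M * n))) * of_real (sqrt (real n)))"
  have summand: "cnj (fourier_mat (M * n) $$ (b * n + t, i)) * symbol_mat M \<A> chi n $$ (b * n + t, j)
      = c * (of_real (chi (real t / real n)) * z ^ t)" if t: "t < n" for t
  proof -
    have j': "j' < n" using n by (simp add: j'_def)
    have "cnj (fourier_mat (M * n) $$ (b * n + t, i)) =
        exp (\<i> * of_real (2 * pi * (real (b * n + t) * real i / real (M * n)))) / of_real (sqrt (real (M * n)))"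
      using bnd[OF t] ij by (simp add: fourier_mat_index exp_cnj del: of_nat_add of_nat_mult)
    moreover have "symbol_mat M \<A> chi n $$ (b * n + t, j) =
        of_real (chi (real t / real n)) * (exp (\<i> * of_real (2 * pi * (- (real t * real j' / real n)))) / of_real (sqrt (real n)))
        * of_real (chi (real j' / real n))"
      using bnd[OF t] t ij b j' by (simp add: symbol_mat_index fourier_mat_index b_def j'_def)
    moreover have "exp (\<i> * of_real (2 * pi * (real (b * n + t) * real i / real (M * n))))
        * exp (\<i> * of_real (2 * pi * (- (real t * real j' / real n)))) = p * z ^ t"
      unfolding p_def z_def exp_of_nat_mult[symmetric] exp_add[symmetric] j'_def
      using n M by (intro arg_cong[where f = exp]) (simp add: field_simps)
    ultimately show ?thesis
      by (simp add: c_def field_simps)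
  qed
  have "baker_mat M \<A> chi (M * n) $$ (i, j) = c * (\<Sum>t<n. of_real (chi (real t / real n)) * z ^ t)"
    unfolding baker_mat_index[OF A n ij] sum_distrib_left
    by (intro sum.cong refl) (use summand in \<open>simp add: b_def\<close>)
  moreover have "cmod c = \<bar>chi (real j' / real n)\<bar> / (sqrt (real (M * n)) * sqrt (real n))"
    by (simp add: c_def p_def norm_mult norm_divide del: of_nat_mult)
  ultimately show ?thesis
    by (simp only: norm_mult j'_def)
qed

text \<open>
  Column \<open>j\<close> is concentrated near row \<open>M (j mod n)\<close>, that is, near the graph of the expanding map
  \<open>x \<mapsto> M x mod 1\<close>. The phase is \<open>\<theta> = (i - M (j mod n)) / (M n)\<close>. The cutoff
  at \<open>(j mod n) / n\<close> forces \<open>\<bar>\<theta>\<bar> \<le> 1 - c\<close>, so there is no second stationary point caused by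
  periodicity.
\<close>

lemma baker_mat_decay:
  assumes "cutoff chi" "\<A> \<subseteq> {0..<M}"
  obtains C where "0 \<le> C"
    "\<And>n i j. i < M * n \<Longrightarrow> j < M * n \<Longrightarrow>
      cmod (baker_mat M \<A> chi (M * n) $$ (i, j)) * \<bar>real i - real M * real (j mod n)\<bar> ^ K \<le> C"
proof -
  obtain C where C: "0 \<le> C" "\<And>n z. 1 \<le> n \<Longrightarrow> cmod z = 1 \<Longrightarrow>
       cmod (1 - z) ^ K * cmod (\<Sum>m<n. of_real (chi (real m / real n)) * z ^ m) \<le> C * real n / real n ^ K"
    using cutoff_exponential_sum[OF assms(1), of K] by blast
  obtain c where c: "0 < c" "c < 1" "\<And>x. chi x \<noteq> 0 \<Longrightarrow> c \<le> x \<and> x \<le> 1 - c"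
    using cutoff_support[OF assms(1)] by metis
  define s where "s = 2 * sin (pi * c)"
  have s: "0 < s" using c by (auto simp: s_def intro!: sin_gt_zero)
  have chi01: "0 \<le> chi x" "chi x \<le> 1" for x
    using assms(1) rangeI[of chi x] unfolding cutoff_def by (auto simp: subset_eq)
  show ?thesis
  proof (rule that[of "(real M / s) ^ K * C"])
    show "0 \<le> (real M / s) ^ K * C" using C s by simp
    fix n i j assume ij: "i < M * n" "j < M * n"
    have n: "0 < n" using ij by (cases n) auto
    have M: "0 < M" using ij by (cases M) auto
    define \<theta> where "\<theta> = (real i - real M * real (j mod n)) / real (M * n)"
    let ?B = "baker_mat M \<A> chi (M * n) $$ (i, j)"
    show "cmod ?B * \<bar>real i - real M * real (j mod n)\<bar> ^ K \<le> (real M / s) ^ K * C"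
    proof (cases "j div n \<in> \<A> \<and> chi (real (j mod n) / real n) \<noteq> 0")
      case False
      have "cmod ?B = 0"
      proof (cases "j div n \<in> \<A>")
        case True
        then show ?thesis
          using False norm_baker_mat_index[OF assms(2) ij True, of chi] by simp
      qed (use baker_mat_outside[OF assms(2) ij] in simp)
      then show ?thesis using C s by simp
    next
      case True
      define z where "z = exp (\<i> * of_real (2 * pi * \<theta>))"
      define S where "S = cmod (\<Sum>t<n. of_real (chi (real t / real n)) * z ^ t)"
      have B: "cmod ?B = \<bar>chi (real (j mod n) / real n)\<bar> / (sqrt (real (M * n)) * sqrt (real n)) * S"
        using norm_baker_mat_index[OF assms(2) ij conjunct1[OF True], of chi]
        unfolding S_def z_def \<theta>_def .
      have "real n = sqrt (real n) * sqrt (real n)" by simp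
      also have "\<dots> \<le> sqrt (real (M * n)) * sqrt (real n)"
        using M mult_right_mono[of 1 "real M" "real n"] by (intro mult_right_mono) auto
      finally have "\<bar>chi (real (j mod n) / real n)\<bar> / (sqrt (real (M * n)) * sqrt (real n)) \<le> 1 / real n"
        using chi01[of "real (j mod n) / real n"] n by (intro frac_le) auto
      then have BS: "cmod ?B \<le> 1 / real n * S"
        unfolding B by (intro mult_right_mono) (auto simp: S_def)
      have "\<bar>\<theta>\<bar> \<le> 1 - c"
      proof -
        have t1: "\<theta> = real i / real (M * n) - real (j mod n) / real n"
          using M n by (simp add: \<theta>_def field_simps)
        have "0 \<le> real i / real (M * n)" "real i / real (M * n) \<le> 1"
          using of_nat_mono[OF less_imp_le[OF ij(1)], where 'a = real] M n by (auto simp: divide_le_eq_1)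
        then show ?thesis using c(3)[OF conjunct2[OF True]] unfolding t1 by linarith
      qed
      from one_minus_exp_lower_bound[OF c(1,2) this]
      have "s * \<bar>\<theta>\<bar> \<le> cmod (1 - z)" by (simp add: s_def z_def)
      then have "(s * \<bar>\<theta>\<bar>) ^ K * S \<le> cmod (1 - z) ^ K * S"
        using s by (intro mult_right_mono power_mono) (auto simp: S_def)
      also have "\<dots> \<le> C * real n / real n ^ K"
        unfolding S_def using n by (intro C(2)) (auto simp: z_def)
      finally have SK: "(s * \<bar>\<theta>\<bar>) ^ K * S \<le> C * real n / real n ^ K" .
      \<comment> \<open>brings in \<open>s * \<bar>\<theta>\<bar>\<close>, the lower bound for \<open>cmod (1 - z)\<close>\<close>
      have d: "\<bar>real i - real M * real (j mod n)\<bar> = real M * real n / s * (s * \<bar>\<theta>\<bar>)"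
        using M n s by (simp add: \<theta>_def abs_divide)
      have "cmod ?B * \<bar>real i - real M * real (j mod n)\<bar> ^ K
          \<le> (1 / real n * S) * (real M * real n / s * (s * \<bar>\<theta>\<bar>)) ^ K"
        unfolding d using BS s by (intro mult_right_mono) auto
      also have "\<dots> = (real M * real n / s) ^ K / real n * ((s * \<bar>\<theta>\<bar>) ^ K * S)"
        by (simp only: power_mult_distrib) (simp add: mult_ac)
      also have "\<dots> \<le> (real M * real n / s) ^ K / real n * (C * real n / real n ^ K)"
        using SK s by (intro mult_left_mono) auto
      also have "\<dots> = (real M / s) ^ K * C"
        using n s by (simp add: power_mult_distrib power_divide)
      finally show ?thesis .
    qed
  qed
qed

section \<open>Hilbert-Schmidt contractions and propagation\<close>

lemma mult_square_carrier [simp]: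
  "A \<in> carrier_mat n n \<Longrightarrow> B \<in> carrier_mat n n \<Longrightarrow> A * B \<in> carrier_mat n n"
  by (rule mult_carrier_mat)

text \<open>
  Operator norm at most one, expressed by the effect on the Hilbert-Schmidt norm, because this is
  how it is used.
\<close>

definition contraction :: "nat \<Rightarrow> complex mat \<Rightarrow> bool" where
  "contraction n A \<longleftrightarrow> A \<in> carrier_mat n n \<and>
     (\<forall>Z \<in> carrier_mat n n. hs_norm (A * Z) \<le> hs_norm Z \<and> hs_norm (Z * A) \<le> hs_norm Z)"

lemma contraction_carrier: "contraction n A \<Longrightarrow> A \<in> carrier_mat n n"
  by (simp add: contraction_def)

lemma contraction_left: "contraction n A \<Longrightarrow> Z \<in> carrier_mat n n \<Longrightarrow> hs_norm (A * Z) \<le> hs_norm Z"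
  by (simp add: contraction_def)

lemma contraction_right: "contraction n A \<Longrightarrow> Z \<in> carrier_mat n n \<Longrightarrow> hs_norm (Z * A) \<le> hs_norm Z"
  by (simp add: contraction_def)

lemma contraction_unitary:
  assumes "U \<in> carrier_mat n n" "mat_adjoint U * U = 1\<^sub>m n" "U * mat_adjoint U = 1\<^sub>m n"
  shows "contraction n U"
  using assms by (simp add: contraction_def hs_norm_unitary_left hs_norm_unitary_right)

lemma contraction_one: "contraction n (1\<^sub>m n)"
  by (simp add: contraction_def)

lemma contraction_mult:
  assumes A: "contraction n A" and B: "contraction n B"
  shows "contraction n (A * B)"
  unfolding contraction_def
proof (intro conjI ballI)
  note C = contraction_carrier[OF A] contraction_carrier[OF B]
  show "A * B \<in> carrier_mat n n" using C by simp
  fix Z :: "complex mat" assume Z: "Z \<in> carrier_mat n n"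
  have "hs_norm (A * (B * Z)) \<le> hs_norm (B * Z)" using C Z by (intro contraction_left[OF A]) simp
  also have "\<dots> \<le> hs_norm Z" using Z by (rule contraction_left[OF B])
  finally show "hs_norm (A * B * Z) \<le> hs_norm Z" by (simp add: assoc_mult_mat[OF C Z])
  have "hs_norm (Z * A * B) \<le> hs_norm (Z * A)" using C Z by (intro contraction_right[OF B]) simp
  also have "\<dots> \<le> hs_norm Z" using Z by (rule contraction_right[OF A])
  finally show "hs_norm (Z * (A * B)) \<le> hs_norm Z" by (simp add: assoc_mult_mat[OF Z C])
qed

lemma contraction_pow: "contraction n A \<Longrightarrow> contraction n (A ^\<^sub>m m)"
proof (induction m)
  case 0
  then show ?case using contraction_one contraction_carrier by (metis carrier_matD(1) pow_mat.simps(1))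
next
  case (Suc m)
  then show ?case by (simp add: contraction_mult)
qed

lemma contraction_transpose:
  assumes "contraction n A"
  shows "contraction n (transpose_mat A)"
  unfolding contraction_def
proof (intro conjI ballI)
  note A = contraction_carrier[OF assms]
  show "transpose_mat A \<in> carrier_mat n n" using A by simp
  fix Z :: "complex mat" assume Z: "Z \<in> carrier_mat n n"
  then have Zt: "transpose_mat Z \<in> carrier_mat n n" by simp
  have "transpose_mat A * Z = transpose_mat (transpose_mat Z * A)"
    using transpose_mult[OF Zt A] by simp
  then show "hs_norm (transpose_mat A * Z) \<le> hs_norm Z"
    using contraction_right[OF assms Zt] by simp
  have "Z * transpose_mat A = transpose_mat (A * transpose_mat Z)"
    using transpose_mult[OF A Zt] by simp
  then show "hs_norm (Z * transpose_mat A) \<le> hs_norm Z"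
    using contraction_left[OF assms Zt] by simp
qed

lemma contraction_diag:
  assumes "\<And>i. i < n \<Longrightarrow> cmod (d i) \<le> 1"
  shows "contraction n (mat_diag n d)"
  unfolding contraction_def
proof (intro conjI ballI)
  fix Z :: "complex mat" assume Z: "Z \<in> carrier_mat n n"
  show "hs_norm (mat_diag n d * Z) \<le> hs_norm Z"
    unfolding mat_diag_mult_left[OF Z]
    by (rule hs_norm_mono[of _ n n]) (use Z assms in \<open>auto simp: norm_mult intro!: mult_left_le_one_le\<close>)
  show "hs_norm (Z * mat_diag n d) \<le> hs_norm Z"
    unfolding mat_diag_mult_right[OF Z]
    by (rule hs_norm_mono[of _ n n]) (use Z assms in \<open>auto simp: norm_mult intro!: mult_right_le_one_le\<close>)
qed simp

definition proj_on :: "nat \<Rightarrow> nat set \<Rightarrow> complex mat" where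
  "proj_on n X = mat_diag n (\<lambda>i. if i \<in> X then 1 else 0)"

lemma proj_on_carrier [simp]: "proj_on n X \<in> carrier_mat n n"
  by (simp add: proj_on_def)

lemma contraction_proj_on: "contraction n (proj_on n X)"
  unfolding proj_on_def by (rule contraction_diag) auto

lemma proj_on_add_Compl: "proj_on n X + proj_on n (- X) = 1\<^sub>m n"
  by (rule eq_matI) (auto simp: proj_on_def mat_diag_def)

lemma proj_on_mult_Compl: "proj_on n X * proj_on n (- X) = 0\<^sub>m n n"
  unfolding proj_on_def mat_diag_diag by (rule eq_matI) (auto simp: mat_diag_def)

lemma proj_on_superset: "{..<n} \<subseteq> X \<Longrightarrow> proj_on n X = 1\<^sub>m n"
  by (rule eq_matI) (auto simp: proj_on_def mat_diag_def)

lemma proj_on_sandwich_index: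
  assumes "A \<in> carrier_mat n n" "i < n" "j < n"
  shows "(proj_on n X * A * proj_on n Y) $$ (i, j) = (if i \<in> X \<and> j \<in> Y then A $$ (i, j) else 0)"
  using assms unfolding proj_on_def
  by (subst mat_diag_mult_right[of _ n]) (auto simp: mat_diag_mult_left[OF assms(1)])

lemma hs_norm_proj_on:
  assumes "X \<subseteq> {..<n}"
  shows "(hs_norm (proj_on n X))\<^sup>2 = real (card X)"
proof -
  have "(hs_norm (proj_on n X))\<^sup>2 = (\<Sum>i<n. \<Sum>j<n. if j = i then (if i \<in> X then 1 else 0) else 0)"
    unfolding hs_norm_sq[OF proj_on_carrier]
    by (intro sum.cong refl) (auto simp: proj_on_def mat_diag_def)
  also have "\<dots> = (\<Sum>i<n. if i \<in> X then 1 else 0)"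
    by (intro sum.cong refl) simp
  also have "\<dots> = real (card ({..<n} \<inter> X))"
    by (simp add: sum.If_cases)
  also have "{..<n} \<inter> X = X" using assms by auto
  finally show ?thesis .
qed

lemma hs_norm_split:
  assumes "A \<in> carrier_mat n n" "B \<in> carrier_mat n n"
  shows "hs_norm (A * B) \<le> hs_norm (A * proj_on n X * B) + hs_norm (A * proj_on n (- X) * B)"
proof -
  have "A * B = A * (proj_on n X + proj_on n (- X)) * B"
    using assms by (simp add: proj_on_add_Compl)
  also have "\<dots> = (A * proj_on n X + A * proj_on n (- X)) * B"
    using assms by (subst mult_add_distrib_mat[of _ n n _ n]) simp_all
  also have "\<dots> = A * proj_on n X * B + A * proj_on n (- X) * B"
    using assms by (subst add_mult_distrib_mat[of _ n n _ _ n]) simp_all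
  finally show ?thesis
    using hs_norm_triangle[of "A * proj_on n X * B" n n "A * proj_on n (- X) * B"] assms by simp
qed

text \<open>
  Think of \<open>X r\<close> as the points that can be followed for \<open>r\<close> steps. If a single step
  from outside \<open>X (r + 1)\<close> into \<open>X r\<close> is nearly impossible, then so are \<open>s\<close> steps
  from outside \<open>X (r + s)\<close> into \<open>X r\<close>. The projection onto \<open>X (r + s)\<close> and its complement are
  inserted before the last factor; as \<open>B\<close> is a contraction, the errors of the steps add up and
  do not multiply.
\<close>

lemma propagation:
  assumes B: "contraction n B" and e: "0 \<le> e"
    and small: "\<And>r i j. i < n \<Longrightarrow> j < n \<Longrightarrow> i \<in> X r \<Longrightarrow> j \<notin> X (Suc r) \<Longrightarrow> cmod (B $$ (i, j)) \<le> e"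
  shows "hs_norm (proj_on n (X r) * B ^\<^sub>m s * proj_on n (- X (r + s))) \<le> real s * (real n * e)"
proof (induction s)
  case 0
  have "B ^\<^sub>m 0 = 1\<^sub>m n" using contraction_carrier[OF B] by simp
  then have "proj_on n (X r) * B ^\<^sub>m 0 * proj_on n (- X (r + 0)) = 0\<^sub>m n n"
    using proj_on_mult_Compl[of n "X r"] right_mult_one_mat[OF proj_on_carrier[of n "X r"]] by simp
  moreover have "(hs_norm (0\<^sub>m n n))\<^sup>2 = 0"
    by (subst hs_norm_sq[of _ n n]) simp_all
  ultimately show ?case by simp
next
  case (Suc s)
  note Bc = contraction_carrier[OF B]
  let ?Q = "proj_on n (X r)" and ?R = "proj_on n (X (r + s))" and ?R' = "proj_on n (- X (r + s))"
    and ?S = "proj_on n (- X (r + Suc s))"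
  define A where "A = ?Q * B ^\<^sub>m s"
  have A: "A \<in> carrier_mat n n" using Bc unfolding A_def by (intro mult_carrier_mat[of _ n n]) simp_all
  have cA: "contraction n A"
    unfolding A_def by (intro contraction_mult contraction_proj_on contraction_pow B)
  have cBS: "contraction n (B * ?S)"
    by (intro contraction_mult contraction_proj_on B)
  note BS = contraction_carrier[OF cBS]
  have RBS: "?R * (B * ?S) \<in> carrier_mat n n"
    using Bc by simp
  have "?Q * B ^\<^sub>m Suc s * ?S = A * (B * ?S)"
  proof -
    have "?Q * B ^\<^sub>m Suc s = A * B"
      unfolding A_def using Bc by (simp add: assoc_mult_mat[of _ n n _ n _ n])
    then show ?thesis
      using A Bc by (simp add: assoc_mult_mat[of _ n n _ n _ n])
  qed
  then have "hs_norm (?Q * B ^\<^sub>m Suc s * ?S) \<le> hs_norm (A * ?R * (B * ?S)) + hs_norm (A * ?R' * (B * ?S))"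
    using hs_norm_split[OF A BS] by simp
  also have "A * ?R * (B * ?S) = A * (?R * (B * ?S))"
    using A BS by (simp add: assoc_mult_mat[of _ n n _ n _ n])
  also have "hs_norm (A * (?R * (B * ?S))) \<le> hs_norm (?R * (B * ?S))"
    by (rule contraction_left[OF cA RBS])
  also have "\<dots> \<le> real n * e"
  proof (rule hs_norm_le_bound[OF RBS e])
    fix i j assume ij: "i < n" "j < n"
    have "?R * (B * ?S) = ?R * B * ?S"
      using Bc by (simp add: assoc_mult_mat[of _ n n _ n _ n])
    then show "cmod ((?R * (B * ?S)) $$ (i, j)) \<le> e"
      using ij e small[of i j "r + s"] by (auto simp: proj_on_sandwich_index[OF Bc ij])
  qed
  also have "hs_norm (A * ?R' * (B * ?S)) \<le> hs_norm (A * ?R')"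
    using A by (intro contraction_right[OF cBS] mult_carrier_mat[of _ n n]) simp_all
  also have "\<dots> \<le> real s * (real n * e)"
    using Suc.IH by (simp add: A_def)
  finally show ?case by (simp add: algebra_simps)
qed

text \<open>
  Give \<open>i\<close> the level \<open>r \<le> q\<close> if it survives \<open>r\<close> stages of \<open>m\<close> steps but not \<open>r + 1\<close>, and the
  weight \<open>t\<close> to the power of its level. Dynamically \<open>B\<^sup>m\<close> moves a column index \<open>j\<close> to a row index \<open>i\<close>
  of lower level, and such entries are multiplied by at most \<open>t\<close>. Entries that do not lower the level
  are negligible by \<open>propagation\<close>, even after the weights multiply them by as much as \<open>t\<close> to the power
  \<open>-q\<close>. The exception is the block from the top level to itself.
  Hence the eigenvalues are controlled by that block alone.

  The number \<open>q\<close> of stages decouples two requirements: the top level should be thin, which takes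
  \<open>q m\<close> steps, whereas the left-hand side loses a factor \<open>\<rho>\<^sup>2\<close> only for each of \<open>m\<close> steps.
\<close>

lemma eigenvalue_count_propagation:
  fixes X :: "nat \<Rightarrow> nat set"
  assumes B: "contraction n B" and e: "0 \<le> e"
    and small: "\<And>r i j. i < n \<Longrightarrow> j < n \<Longrightarrow> i \<in> X r \<Longrightarrow> j \<notin> X (Suc r) \<Longrightarrow> cmod (B $$ (i, j)) \<le> e"
    and X0: "{..<n} \<subseteq> X 0" and dec: "antimono X"
    and \<rho>: "0 \<le> \<rho>" and t: "0 < t" "t \<le> 1"
  shows "real (eigenvalue_count B \<rho>) * \<rho> ^ (2 * m) \<le>
    (hs_norm (proj_on n (X (q * m)) * B ^\<^sub>m m * proj_on n (X (q * m))))\<^sup>2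
      + t\<^sup>2 * real n + (real n * (real m * (real n * e)) / t ^ q)\<^sup>2"
proof -
  define \<eta> where "\<eta> = real m * (real n * e)"
  have \<eta>: "0 \<le> \<eta>" using e by (simp add: \<eta>_def)
  note Bc = contraction_carrier[OF B]
  define A where "A = B ^\<^sub>m m"
  have A: "A \<in> carrier_mat n n" using Bc by (simp add: A_def)
  define lev where "lev i = Max {r. r \<le> q \<and> i \<in> X (r * m)}" for i
  have fin: "finite {r. r \<le> q \<and> i \<in> X (r * m)}" for i by simp
  have ne: "{r. r \<le> q \<and> i \<in> X (r * m)} \<noteq> {}" if "i < n" for i
    using that X0 by (auto intro!: exI[of _ 0])
  have lev: "lev i \<le> q" "i \<in> X (lev i * m)" if "i < n" for i
    using Max_in[OF fin ne[OF that]] by (auto simp: lev_def)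
  have lev_max: "i \<notin> X (Suc (lev i) * m)" if "i < n" "lev i < q" for i
  proof
    assume "i \<in> X (Suc (lev i) * m)"
    then have "Suc (lev i) \<le> lev i"
      using that unfolding lev_def by (intro Max_ge[OF fin]) (auto simp: lev_def)
    then show False by simp
  qed
  let ?w = "\<lambda>i. t ^ lev i"
  let ?Y = "X (q * m)"
  let ?Q = "proj_on n ?Y"
  have entry: "(?w j / ?w i * cmod (A $$ (i, j)))\<^sup>2 \<le>
      (cmod ((?Q * A * ?Q) $$ (i, j)))\<^sup>2 + t\<^sup>2 * (cmod (A $$ (i, j)))\<^sup>2 + (\<eta> / t ^ q)\<^sup>2"
    if i: "i < n" and j: "j < n" for i j
  proof (cases "lev i < lev j")
    case True
    \<comment> \<open>the index loses at least one level: gain a factor \<open>t\<close>\<close>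
    have "?w j \<le> t * ?w i"
      using t True power_decreasing[of "Suc (lev i)" "lev j" t] by simp
    then have "?w j / ?w i \<le> t"
      using t by (simp add: divide_le_eq)
    then have "(?w j / ?w i * cmod (A $$ (i, j)))\<^sup>2 \<le> (t * cmod (A $$ (i, j)))\<^sup>2"
      using t by (intro power_mono mult_right_mono) auto
    then show ?thesis
      by (simp add: power_mult_distrib add_increasing add_increasing2)
  next
    case le: False
    show ?thesis
    proof (cases "lev j = q")
      case True
      \<comment> \<open>both indices have the top level: the entry survives unweighted\<close>
      then have "lev i = q" using le lev(1)[OF i] by simp
      then have "i \<in> ?Y" "j \<in> ?Y" "?w j / ?w i = 1"
        using lev(2)[OF i] lev(2)[OF j] True t by auto
      then show ?thesis
        by (simp add: proj_on_sandwich_index[OF A i j] add_increasing2)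
    next
      case False
      then have jq: "lev j < q" using lev(1)[OF j] by simp
      \<comment> \<open>no level is lost although \<open>j\<close> is below the top: \<open>propagation\<close> makes the entry small\<close>
      define r where "r = lev j * m"
      have "lev j * m \<le> lev i * m" using le by (intro mult_right_mono) auto
      then have "i \<in> X r"
        using lev(2)[OF i] dec unfolding r_def antimono_def by blast
      moreover have "j \<notin> X (r + m)"
        using lev_max[OF j jq] by (simp add: r_def add.commute)
      ultimately have "cmod (A $$ (i, j)) = cmod ((proj_on n (X r) * A * proj_on n (- X (r + m))) $$ (i, j))"
        by (simp add: proj_on_sandwich_index[OF A i j])
      also have "\<dots> \<le> hs_norm (proj_on n (X r) * A * proj_on n (- X (r + m)))"
        using i j A by (intro cmod_le_hs_norm[of _ n n] mult_carrier_mat[of _ n n]) simp_all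
      also have "\<dots> \<le> \<eta>"
        unfolding A_def \<eta>_def by (rule propagation[OF B e small])
      finally have g: "cmod (A $$ (i, j)) \<le> \<eta>" .
      have "?w j / ?w i \<le> 1 / t ^ q"
        using t lev(1)[OF i] by (intro frac_le power_decreasing power_le_one) auto
      then have "?w j / ?w i * cmod (A $$ (i, j)) \<le> 1 / t ^ q * \<eta>"
        using g t by (intro mult_mono) auto
      then have "(?w j / ?w i * cmod (A $$ (i, j)))\<^sup>2 \<le> (\<eta> / t ^ q)\<^sup>2"
        using t by (intro power_mono) auto
      then show ?thesis
        by (simp add: add_increasing)
    qed
  qed
  have "real (eigenvalue_count B \<rho>) * \<rho> ^ (2 * m) \<le> (\<Sum>i<n. \<Sum>j<n. (?w j / ?w i * cmod (A $$ (i, j)))\<^sup>2)"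
    unfolding A_def by (rule eigenvalue_count_le_hs_norm[OF Bc \<rho>]) (use t in simp)
  also have "\<dots> \<le> (\<Sum>i<n. \<Sum>j<n. (cmod ((?Q * A * ?Q) $$ (i, j)))\<^sup>2 + t\<^sup>2 * (cmod (A $$ (i, j)))\<^sup>2 + (\<eta> / t ^ q)\<^sup>2)"
    by (intro sum_mono) (use entry in auto)
  also have "\<dots> = (hs_norm (?Q * A * ?Q))\<^sup>2 + t\<^sup>2 * (hs_norm A)\<^sup>2 + (real n * \<eta> / t ^ q)\<^sup>2"
  proof -
    have "?Q * A * ?Q \<in> carrier_mat n n" using A by (intro mult_carrier_mat[of _ n n]) simp_all
    from hs_norm_sq[OF this] show ?thesis
      by (simp add: hs_norm_sq[OF A] sum.distrib sum_distrib_left power_mult_distrib power_divide power2_eq_square[of "real n"])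
  qed
  also have "(hs_norm A)\<^sup>2 \<le> real n"
  proof -
    have "hs_norm A \<le> hs_norm (1\<^sub>m n)"
      using contraction_left[OF contraction_pow[OF B], of "1\<^sub>m n" m] right_mult_one_mat[OF A]
      by (simp add: A_def)
    then have "(hs_norm A)\<^sup>2 \<le> (hs_norm (1\<^sub>m n))\<^sup>2" by (intro power_mono) auto
    also have "1\<^sub>m n = proj_on n {..<n}" by (simp add: proj_on_superset)
    finally show ?thesis by (simp add: hs_norm_proj_on)
  qed
  finally show ?thesis
    by (simp add: A_def \<eta>_def mult_left_mono)
qed

section \<open>The uncertainty estimate\<close>

lemma contraction_baker_mat:
  assumes "cutoff chi" "\<A> \<subseteq> {0..<M}" "0 < n"
  shows "contraction (M * n) (baker_mat M \<A> chi (M * n))"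
proof (cases "M = 0")
  case True
  then show ?thesis
    by (simp add: contraction_def hs_norm_def baker_mat_def)
next
  case False
  have "\<bar>chi x\<bar> \<le> 1" for x
    using assms(1) rangeI[of chi x] unfolding cutoff_def by (auto simp: subset_eq)
  then have D: "contraction (M * n) (block_cutoff M \<A> chi n)"
    unfolding block_cutoff_def by (intro contraction_diag) auto
  have "contraction (M * n) (mat_adjoint (fourier_mat (M * n)))"
    by (rule contraction_unitary) (simp_all add: fourier_mat_unitary)
  moreover have "contraction (M * n) (block_fourier M n)"
    by (rule contraction_unitary) (simp_all add: block_fourier_unitary)
  ultimately show ?thesis
    unfolding baker_mat_factorization[OF assms(2,3) False[unfolded neq0_conv]] symbol_mat_def
    by (intro contraction_mult D)
qed

lemma transpose_pow_mat:
  fixes A :: "complex mat"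
  assumes A: "A \<in> carrier_mat n n"
  shows "transpose_mat (A ^\<^sub>m m) = transpose_mat A ^\<^sub>m m"
proof (induction m)
  case 0
  then show ?case using A by simp
next
  case (Suc m)
  have At: "transpose_mat A \<in> carrier_mat n n" using A by simp
  have comm: "transpose_mat A * transpose_mat A ^\<^sub>m k = transpose_mat A ^\<^sub>m k * transpose_mat A" for k
  proof (induction k)
    case 0
    then show ?case using At by simp
  next
    case (Suc k)
    have Ak: "transpose_mat A ^\<^sub>m k \<in> carrier_mat n n" using At by simp
    show ?case
      unfolding pow_mat.simps assoc_mult_mat[OF At Ak At, symmetric] Suc ..
  qed
  have "transpose_mat (A ^\<^sub>m m * A) = transpose_mat A * transpose_mat (A ^\<^sub>m m)"
    using A by (intro transpose_mult[of _ n n _ n]) simp_all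
  then show ?case using comm Suc by simp
qed

text \<open>
  Write \<open>B = F\<^sup>* G\<close> with \<open>G\<close> symmetric. As \<open>F\<close> is symmetric too, the transpose of \<open>B\<close> is \<open>G F\<^sup>*\<close>, which
  is unitarily conjugate to \<open>B\<close>. Localisation of \<open>B\<^sup>m\<close> in position before the evolution
  thus becomes localisation in frequency after it.
\<close>

lemma baker_mat_pow_fourier:
  fixes chi :: "real \<Rightarrow> real"
  assumes "\<A> \<subseteq> {0..<M}" "0 < n" "0 < M"
  defines "F \<equiv> fourier_mat (M * n)" and "B \<equiv> baker_mat M \<A> chi (M * n)"
  shows "B ^\<^sub>m m = mat_adjoint F * transpose_mat (B ^\<^sub>m m) * F"
proof -
  let ?N = "M * n" and ?G = "symbol_mat M \<A> chi n"
  have F: "F \<in> carrier_mat ?N ?N" by (simp add: F_def)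
  have F': "mat_adjoint F \<in> carrier_mat ?N ?N" by (simp add: F_def)
  have G: "?G \<in> carrier_mat ?N ?N" by simp
  have Bc: "B \<in> carrier_mat ?N ?N" by (simp add: B_def)
  have FF: "mat_adjoint F * F = 1\<^sub>m ?N" "F * mat_adjoint F = 1\<^sub>m ?N"
    by (simp_all add: F_def fourier_mat_unitary)
  have B: "B = mat_adjoint F * ?G"
    using baker_mat_factorization[OF assms(1-3)] by (simp add: B_def F_def)
  have "transpose_mat (mat_adjoint F) = mat_adjoint F"
    by (rule eq_matI) (simp_all add: F_def fourier_mat_index mult.commute)
  then have Bt: "transpose_mat B = ?G * mat_adjoint F"
    unfolding B transpose_mult[OF F' G] by (simp add: symbol_mat_transpose)
  have "mat_adjoint F * transpose_mat B * F = mat_adjoint F * (?G * mat_adjoint F * F)"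
    unfolding Bt using F F' G by (intro assoc_mult_mat[of _ ?N ?N _ ?N _ ?N]) simp_all
  also have "?G * mat_adjoint F * F = ?G * (mat_adjoint F * F)"
    by (rule assoc_mult_mat[OF G F' F])
  also have "\<dots> = ?G" using FF G by simp
  finally have eq: "B = mat_adjoint F * transpose_mat B * F" using B by simp
  have "similar_mat_wit B (transpose_mat B) (mat_adjoint F) F"
    by (rule similar_mat_witI[of _ _ ?N, OF FF eq]) (use Bc F F' in simp_all)
  from similar_mat_wit_pow_id[OF this, of m] show ?thesis
    unfolding transpose_pow_mat[OF Bc] .
qed

text \<open>
  All entries of the Fourier matrix have modulus \<open>1 / sqrt N\<close>.
\<close>

lemma hs_norm_proj_fourier_proj:
  assumes "X \<subseteq> {..<N}" "0 < N"
  shows "hs_norm (proj_on N X * mat_adjoint (fourier_mat N) * proj_on N X) = real (card X) / sqrt (real N)"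
proof -
  let ?P = "proj_on N X * mat_adjoint (fourier_mat N) * proj_on N X"
  have "(hs_norm ?P)\<^sup>2 = (\<Sum>i<N. \<Sum>j<N. if i \<in> X \<and> j \<in> X then 1 / real N else 0)"
    unfolding hs_norm_sq[of ?P N N, simplified]
    using assms(2)
    by (intro sum.cong refl)
      (simp add: proj_on_sandwich_index[of _ N] fourier_mat_index norm_divide power_divide)
  also have "\<dots> = (\<Sum>i<N. if i \<in> X then (\<Sum>j<N. if j \<in> X then 1 / real N else 0) else 0)"
    by (intro sum.cong refl) auto
  also have "\<dots> = real (card X) * (real (card X) / real N)"
    using assms(1) by (simp add: sum.If_cases Int_absorb1)
  also have "\<dots> = (real (card X) / sqrt (real N))\<^sup>2"
    by (simp add: power_divide power2_eq_square)
  finally show ?thesis by (rule power2_eq_imp_eq) simp_all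
qed

text \<open>
  In \<open>B\<^sup>m = F\<^sup>* (B\<^sup>m)\<^sup>T F\<close> the middle factor is localised to \<open>X\<close> on its left, up to the error on the right-hand
  side. Between this and the projection onto \<open>X\<close> in position stands only \<open>F\<^sup>*\<close>, so that the
  product contains \<open>1\<^sub>X F\<^sup>* 1\<^sub>X\<close>; the other factors are contractions.
\<close>

lemma hs_norm_baker_uncertainty:
  assumes chi: "cutoff chi" and A: "\<A> \<subseteq> {0..<M}" and n: "0 < n" and M: "0 < M" and X: "X \<subseteq> {..<M * n}"
  defines "N \<equiv> M * n" and "B \<equiv> baker_mat M \<A> chi (M * n)"
  shows "hs_norm (proj_on N X * B ^\<^sub>m m * proj_on N X)
    \<le> real (card X) / sqrt (real N) + hs_norm (B ^\<^sub>m m * proj_on N (- X))"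
proof -
  define F where "F = fourier_mat N"
  define T where "T = transpose_mat (B ^\<^sub>m m)"
  let ?Q = "proj_on N X" and ?Q' = "proj_on N (- X)"
  have cB: "contraction N B"
    unfolding B_def N_def by (rule contraction_baker_mat[OF chi A n])
  note Bc = contraction_carrier[OF cB]
  have cT: "contraction N T"
    unfolding T_def by (intro contraction_transpose contraction_pow cB)
  note T = contraction_carrier[OF cT]
  have cF: "contraction N F" "contraction N (mat_adjoint F)"
    by (rule contraction_unitary; simp add: F_def fourier_mat_unitary)+
  note F = contraction_carrier[OF cF(1)] contraction_carrier[OF cF(2)]
  note Q = proj_on_carrier[of N X] proj_on_carrier[of N "- X"]
  have cQ: "contraction N ?Q" by (rule contraction_proj_on)
  define R where "R = ?Q * mat_adjoint F"
  have cR: "contraction N R" unfolding R_def by (intro contraction_mult cQ cF)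
  note R = contraction_carrier[OF cR]
  define S where "S = F * ?Q"
  have cS: "contraction N S" unfolding S_def by (intro contraction_mult cQ cF)
  note S = contraction_carrier[OF cS]
  have cTS: "contraction N (T * S)" by (intro contraction_mult cT cS)
  note TS = contraction_carrier[OF cTS]
  \<comment> \<open>\<open>R\<close> and \<open>T * S\<close> are contractions; \<open>X\<close> is now inserted between them\<close>
  have "?Q * B ^\<^sub>m m * ?Q = ?Q * (mat_adjoint F * T * F) * ?Q"
    using baker_mat_pow_fourier[OF A n M, of chi m] unfolding B_def T_def F_def N_def by simp
  also have "\<dots> = R * (T * S)"
    unfolding R_def S_def using Q F T
    by (simp add: assoc_mult_mat[of _ N N _ N _ N])
  finally have "hs_norm (?Q * B ^\<^sub>m m * ?Q) \<le> hs_norm (R * ?Q * (T * S)) + hs_norm (R * ?Q' * (T * S))"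
    using hs_norm_split[OF R TS] by simp
  also have "hs_norm (R * ?Q * (T * S)) \<le> hs_norm (R * ?Q)"
    using R Q by (intro contraction_right[OF cTS]) simp
  also have "hs_norm (R * ?Q) = real (card X) / sqrt (real N)"
    unfolding R_def F_def using X M n by (intro hs_norm_proj_fourier_proj) (simp_all add: N_def)
  also have "R * ?Q' * (T * S) = R * ((?Q' * T) * S)"
    using R Q T S by (simp add: assoc_mult_mat[of _ N N _ N _ N])
  also have "hs_norm (R * ((?Q' * T) * S)) \<le> hs_norm ((?Q' * T) * S)"
    using Q T S by (intro contraction_left[OF cR]) simp
  also have "\<dots> \<le> hs_norm (?Q' * T)"
    using Q T by (intro contraction_right[OF cS]) simp
  also have "?Q' * T = transpose_mat (B ^\<^sub>m m * ?Q')"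
  proof -
    have "transpose_mat ?Q' = ?Q'"
      by (rule eq_matI) (auto simp: proj_on_def mat_diag_def)
    then show ?thesis
      unfolding T_def using transpose_mult[of "B ^\<^sub>m m" N N ?Q' N] Bc by simp
  qed
  finally show ?thesis by simp
qed

section \<open>Trapped sets\<close>

text \<open>
  The points that follow the expanding map for \<open>r\<close> steps inside the blocks of the alphabet,
  where an error \<open>L\<close> is tolerated in each step. After rescaling by \<open>M n\<close> this is
  the \<open>r\<close>-th stage of the construction of the Cantor set, slightly thickened.
\<close>

primrec trapped :: "nat \<Rightarrow> nat \<Rightarrow> nat set \<Rightarrow> real \<Rightarrow> nat \<Rightarrow> nat set" where
  "trapped M n \<A> L 0 = {..<M * n}"
| "trapped M n \<A> L (Suc r) = {l. l < M * n \<and> l div n \<in> \<A> \<and>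
     (\<exists>i\<in>trapped M n \<A> L r. \<bar>real i - real M * real (l mod n)\<bar> \<le> L)}"

lemma trapped_subset: "trapped M n \<A> L r \<subseteq> {..<M * n}"
  by (cases r) auto

lemma antimono_trapped: "antimono (trapped M n \<A> L)"
proof -
  have "trapped M n \<A> L (Suc r) \<subseteq> trapped M n \<A> L r" for r
    by (induction r) auto
  then show ?thesis
    by (intro antimonoI) (rule lift_Suc_antimono_le[of "trapped M n \<A> L"])
qed

lemma card_nat_interval_le:
  fixes a b :: real
  assumes "a \<le> b"
  shows "real (card {l :: nat. a \<le> real l \<and> real l \<le> b}) \<le> b - a + 1"
    and "finite {l :: nat. a \<le> real l \<and> real l \<le> b}"
proof -
  let ?S = "{l :: nat. a \<le> real l \<and> real l \<le> b}"
  have sub: "int ` ?S \<subseteq> {\<lceil>a\<rceil>..\<lfloor>b\<rfloor>}"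
    by (auto simp: ceiling_le_iff le_floor_iff)
  have inj: "inj_on int ?S" by (simp add: inj_on_def)
  show "finite ?S"
    by (rule finite_imageD[OF finite_subset[OF sub] inj]) simp
  have "card ?S = card (int ` ?S)" by (simp add: card_image inj)
  also have "\<dots> \<le> card {\<lceil>a\<rceil>..\<lfloor>b\<rfloor>}" using sub by (intro card_mono) simp_all
  finally have "card ?S \<le> nat (\<lfloor>b\<rfloor> - \<lceil>a\<rceil> + 1)" by simp
  then have "real (card ?S) \<le> max 0 (of_int (\<lfloor>b\<rfloor> - \<lceil>a\<rceil> + 1))"
    by linarith
  also have "\<dots> \<le> b - a + 1"
  proof -
    have "real_of_int (\<lfloor>b\<rfloor> - \<lceil>a\<rceil> + 1) \<le> b - a + 1"
      unfolding of_int_add of_int_diff of_int_1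
      using of_int_floor_le[of b] le_of_int_ceiling[of a] by linarith
    then show ?thesis using assms by simp
  qed
  finally show "real (card ?S) \<le> b - a + 1" .
qed

text \<open>
  Pulling back through a branch \<open>l \<mapsto> M l - a M n\<close> divides lengths by \<open>M\<close>. The old error \<open>L\<close> and
  the new one together become \<open>2 L / M \<le> L\<close>, so the errors do not accumulate.
\<close>

lemma trapped_cover:
  assumes "finite \<A>" "2 \<le> M" "0 \<le> L" "0 < n"
  shows "\<exists>Y :: real set. finite Y \<and> card Y \<le> card \<A> ^ r \<and>
    trapped M n \<A> L r \<subseteq> (\<Union>y\<in>Y. {l. y - L \<le> real l \<and> real l \<le> y + real (M * n) / real M ^ r + L})"
proof (induction r)
  case 0
  then show ?case using assms by (intro exI[of _ "{0}"]) (auto simp del: of_nat_mult)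
next
  case (Suc r)
  then obtain Y where Y: "finite Y" "card Y \<le> card \<A> ^ r"
    and sub: "trapped M n \<A> L r \<subseteq> (\<Union>y\<in>Y. {l. y - L \<le> real l \<and> real l \<le> y + real (M * n) / real M ^ r + L})"
    by blast
  define g where "g = (\<lambda>(a, y). (real a * real (M * n) + y) / real M)"
  have "card (g ` (\<A> \<times> Y)) \<le> card \<A> * card Y"
    using card_image_le[of "\<A> \<times> Y" g] assms(1) Y(1) by (simp add: card_cartesian_product)
  also have "\<dots> \<le> card \<A> ^ Suc r" using Y(2) by simp
  finally have card: "card (g ` (\<A> \<times> Y)) \<le> card \<A> ^ Suc r" .
  have "\<exists>y\<in>g ` (\<A> \<times> Y). y - L \<le> real l \<and> real l \<le> y + real (M * n) / real M ^ Suc r + L"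
    if l: "l \<in> trapped M n \<A> L (Suc r)" for l
  proof -
    obtain i where i: "i \<in> trapped M n \<A> L r" "\<bar>real i - real M * real (l mod n)\<bar> \<le> L" and a: "l div n \<in> \<A>"
      using l by auto
    obtain y where y: "y \<in> Y" "y - L \<le> real i" "real i \<le> y + real (M * n) / real M ^ r + L"
      using sub i(1) by blast
    define y' where "y' = g (l div n, y)"
    have M: "0 < real M" using assms by simp
    have "real l = real (l div n) * real n + real (l mod n)"
      by (metis div_mult_mod_eq of_nat_add of_nat_mult)
    then have Ml: "real M * real l = real (l div n) * real (M * n) + real M * real (l mod n)"
      by (simp add: algebra_simps)
    have My: "real M * y' = real (l div n) * real (M * n) + y"
      using M by (simp add: y'_def g_def)
    \<comment> \<open>the old and the new error, divided by \<open>M\<close>, fit into \<open>L\<close>\<close>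
    have ML2: "2 * L \<le> real M * L" using assms by (intro mult_right_mono) auto
    have "real M * (y' - L) \<le> real M * real l"
      using i(2) y(2) Ml My ML2 unfolding right_diff_distrib by linarith
    then have lower: "y' - L \<le> real l" using M by simp
    have "real M * (y' + real (M * n) / real M ^ Suc r + L) = real M * y' + real (M * n) / real M ^ r + real M * L"
      using M by (simp add: field_simps)
    then have "real M * real l \<le> real M * (y' + real (M * n) / real M ^ Suc r + L)"
      using i(2) y(3) Ml My ML2 by linarith
    then have "real l \<le> y' + real (M * n) / real M ^ Suc r + L"
      using M by (simp only: mult_le_cancel_left_pos)
    with lower a y(1) show ?thesis
      by (intro bexI[of _ y']) (auto simp: y'_def)
  qed
  then have "trapped M n \<A> L (Suc r) \<subseteq> (\<Union>y\<in>g ` (\<A> \<times> Y).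
      {l. y - L \<le> real l \<and> real l \<le> y + real (M * n) / real M ^ Suc r + L})"
    by (simp only: subset_iff UN_iff mem_Collect_eq) blast
  moreover have "finite (g ` (\<A> \<times> Y))" using Y(1) assms(1) by simp
  ultimately show ?case using card by (intro exI[of _ "g ` (\<A> \<times> Y)"] conjI)
qed

lemma card_trapped:
  assumes "finite \<A>" "2 \<le> M" "0 \<le> L" "0 < n"
  shows "real (card (trapped M n \<A> L r)) \<le> real (card \<A>) ^ r * (real (M * n) / real M ^ r + 2 * L + 1)"
proof -
  let ?w = "real (M * n) / real M ^ r"
  let ?I = "\<lambda>y. {l :: nat. y - L \<le> real l \<and> real l \<le> y + ?w + L}"
  obtain Y :: "real set" where Y: "finite Y" "card Y \<le> card \<A> ^ r" "trapped M n \<A> L r \<subseteq> (\<Union>y\<in>Y. ?I y)"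
    using trapped_cover[OF assms] by blast
  have w: "0 \<le> ?w" by simp
  have le_bd: "y - L \<le> y + ?w + L" for y using w assms(3) by linarith
  have "card (trapped M n \<A> L r) \<le> card (\<Union>y\<in>Y. ?I y)"
    using Y(1,3) card_nat_interval_le(2)[OF le_bd] by (intro card_mono) auto
  also have "\<dots> \<le> (\<Sum>y\<in>Y. card (?I y))"
    by (rule card_UN_le[OF Y(1)])
  finally have "real (card (trapped M n \<A> L r)) \<le> (\<Sum>y\<in>Y. real (card (?I y)))"
    unfolding of_nat_sum[symmetric] of_nat_le_iff .
  also have "\<dots> \<le> (\<Sum>y\<in>Y. ?w + 2 * L + 1)"
  proof (rule sum_mono)
    fix y show "real (card (?I y)) \<le> ?w + 2 * L + 1"
      using card_nat_interval_le(1)[OF le_bd[of y]] by linarith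
  qed
  also have "\<dots> = real (card Y) * (?w + 2 * L + 1)"
    by simp
  also have "\<dots> \<le> real (card \<A>) ^ r * (?w + 2 * L + 1)"
  proof (rule mult_right_mono)
    show "real (card Y) \<le> real (card \<A>) ^ r" 
      using Y(2) unfolding of_nat_power[symmetric] of_nat_le_iff .
  qed (use w assms(3) in linarith)
  finally show ?thesis .
qed

section \<open>Counting eigenvalues\<close>

text \<open>
  Here \<open>x\<close> is the number of points trapped for \<open>q m \<ge> k\<close> steps with tolerance \<open>L = N\<^sup>\<tau>\<close>, where
  \<open>m = k div q + 1\<close>. The first bound uses only that the projection onto these points has rank \<open>x\<close>.
  The second uses the uncertainty estimate; there the projection time \<open>q m\<close> has to be the
  exponent \<open>m\<close>, whence \<open>q = 1\<close>.
\<close>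

lemma baker_count_bound:
  fixes chi :: "real \<Rightarrow> real" and \<tau> \<nu> :: real
  assumes A: "\<A> \<subseteq> {0..<M}" and M: "2 \<le> M" and chi: "cutoff chi" and q: "1 \<le> q" and \<tau>: "0 < \<tau>"
  obtains C where "0 \<le> C"
    "\<And>k. 1 \<le> k \<Longrightarrow> \<exists>x. 0 \<le> x \<and> x \<le> 4 * real (card \<A>) ^ (k + q) * real (M ^ k) powr \<tau> \<and>
      real (baker_count M \<A> chi k \<nu>) * (real M powr - \<nu>) ^ (2 * (k div q + 1)) \<le> x + C / real (M ^ k) \<and>
      (q = 1 \<longrightarrow> real (baker_count M \<A> chi k \<nu>) * (real M powr - \<nu>) ^ (2 * (k div q + 1))
         \<le> 2 * x\<^sup>2 / real (M ^ k) + C / real (M ^ k))"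
proof -
  \<comment> \<open>the decay must beat the polynomial loss \<open>N\<^sup>q\<^sup>+\<^sup>3\<close> below and leave a factor \<open>1 / N\<close>\<close>
  define K where "K = nat \<lceil>(real q + 4) / \<tau>\<rceil>"
  have "(real q + 4) / \<tau> \<le> real K" unfolding K_def by linarith
  then have K: "real q + 4 \<le> \<tau> * real K" using \<tau> by (simp add: field_simps)
  obtain C0 where C0: "0 \<le> C0"
    "\<And>n i j. i < M * n \<Longrightarrow> j < M * n \<Longrightarrow>
      cmod (baker_mat M \<A> chi (M * n) $$ (i, j)) * \<bar>real i - real M * real (j mod n)\<bar> ^ K \<le> C0"
    using baker_mat_decay[OF chi A] by blast
  show ?thesis
  proof (rule that[of "1 + 3 * C0\<^sup>2"])
    fix k :: nat assume k: "1 \<le> k"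
    define n where "n = M ^ (k - 1)"
    have n: "0 < n" using M by (simp add: n_def)
    have Nn: "M ^ k = M * n" using k by (simp add: n_def power_eq_if)
    define N where "N = real (M ^ k)"
    have N1: "1 \<le> N" unfolding N_def using M by (simp del: of_nat_power)
    have NMn: "real (M * n) = N" by (simp add: N_def Nn)
    define m where "m = k div q + 1"
    define L where "L = N powr \<tau>"
    have L: "1 \<le> L" using N1 \<tau> by (simp add: L_def ge_one_powr_ge_zero)
    define e where "e = C0 / L ^ K"
    have e: "0 \<le> e" using C0 L by (simp add: e_def)
    define B where "B = baker_mat M \<A> chi (M * n)"
    define X where "X = trapped M n \<A> L"
    have cB: "contraction (M * n) B"
      unfolding B_def by (rule contraction_baker_mat[OF chi A n])
    have small: "cmod (B $$ (i, j)) \<le> e"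
      if "i < M * n" "j < M * n" "i \<in> X r" "j \<notin> X (Suc r)" for r i j
    proof (cases "j div n \<in> \<A>")
      case False
      then show ?thesis
        using baker_mat_outside[OF A that(1,2) False] e by (simp add: B_def)
    next
      case True
      then have "L < \<bar>real i - real M * real (j mod n)\<bar>"
        using that by (force simp: X_def)
      then have "cmod (B $$ (i, j)) * L ^ K \<le> cmod (B $$ (i, j)) * \<bar>real i - real M * real (j mod n)\<bar> ^ K"
        using L by (intro mult_left_mono power_mono) auto
      also have "\<dots> \<le> C0"
        unfolding B_def by (rule C0(2)[OF that(1,2)])
      finally show ?thesis using L by (simp add: e_def le_divide_eq)
    qed
    have mN: "real m \<le> N"
    proof -
      have "m \<le> Suc k" unfolding m_def using div_le_dividend[of k q] by simp
      also have "Suc k \<le> 2 ^ k" by (rule Suc_leI[OF less_exp])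
      also have "(2 :: nat) ^ k \<le> M ^ k" using M by (intro power_mono) auto
      finally show ?thesis unfolding N_def by (simp only: of_nat_le_iff)
    qed
    have err: "N ^ (q + 3) * e \<le> C0 / N"
    proof -
      have "N ^ (q + 4) = N powr (real q + 4)"
        using N1 powr_realpow[of N "q + 4"] by (simp add: add.commute)
      also have "\<dots> \<le> N powr (\<tau> * real K)"
        using N1 K by (intro powr_mono) auto
      also have "\<dots> = L ^ K"
        using N1 L by (simp add: L_def powr_powr[symmetric] powr_realpow)
      finally have le: "N ^ (q + 4) \<le> L ^ K" .
      have "N ^ (q + 4) * C0 \<le> L ^ K * C0"
        using le C0 by (intro mult_right_mono) auto
      moreover have "N ^ (q + 4) = N * N ^ (q + 3)" by (simp add: power_add numeral_eq_Suc)
      ultimately show ?thesis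
        using N1 L by (simp add: e_def field_simps)
    qed
    have C0N: "(C0 / N)\<^sup>2 \<le> C0\<^sup>2 / N"
    proof -
      have "C0\<^sup>2 / N\<^sup>2 \<le> C0\<^sup>2 / N"
        using N1 by (intro frac_le) (auto simp: power2_eq_square)
      then show ?thesis by (simp add: power_divide)
    qed
    let ?Q = "proj_on (M * n) (X (q * m))"
    define c where "c = real (baker_count M \<A> chi k \<nu>) * (real M powr - \<nu>) ^ (2 * m)"
    \<comment> \<open>the weights are powers of \<open>t = 1 / N\<close>\<close>
    have c_le: "c \<le> (hs_norm (?Q * B ^\<^sub>m m * ?Q))\<^sup>2 + 1 / N + C0\<^sup>2 / N"
    proof -
      have "c \<le> (hs_norm (?Q * B ^\<^sub>m m * ?Q))\<^sup>2
          + (1 / N)\<^sup>2 * real (M * n) + (real (M * n) * (real m * (real (M * n) * e)) / (1 / N) ^ q)\<^sup>2"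
        unfolding c_def baker_count_def Nn B_def[symmetric]
        by (rule eigenvalue_count_propagation[OF cB e small])
          (use N1 in \<open>auto simp: X_def antimono_trapped\<close>)
      also have "(1 / N)\<^sup>2 * real (M * n) = 1 / N"
        unfolding NMn using N1 by (simp add: power2_eq_square)
      also have "real (M * n) * (real m * (real (M * n) * e)) / (1 / N) ^ q = real m * (N ^ (q + 2) * e)"
        unfolding NMn using N1 by (simp add: power_divide power_add power2_eq_square mult_ac)
      also have "(real m * (N ^ (q + 2) * e))\<^sup>2 \<le> (C0 / N)\<^sup>2"
      proof (rule power_mono)
        have "real m * (N ^ (q + 2) * e) \<le> N * (N ^ (q + 2) * e)"
          using mN N1 e by (intro mult_right_mono) auto
        also have "\<dots> = N ^ (q + 3) * e" by (simp add: numeral_eq_Suc mult_ac)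
        also note err
        finally show "real m * (N ^ (q + 2) * e) \<le> C0 / N" .
      qed (use N1 e in auto)
      also note C0N
      finally show ?thesis by simp
    qed
    define x where "x = real (card (X (q * m)))"
    have x_le: "x \<le> 4 * real (card \<A>) ^ (k + q) * L"
    proof -
      have fin: "finite \<A>" using A finite_subset by blast
      show ?thesis
      proof (cases "card \<A> = 0")
        case True
        then have "\<A> = {}" using fin by simp
        moreover have "0 < q * m" using q by (simp add: m_def)
        then obtain r where "q * m = Suc r" by (cases "q * m") auto
        ultimately have "X (q * m) = {}" by (simp add: X_def)
        then show ?thesis using L by (simp add: x_def)
      next
        case False
        have qm: "k \<le> q * m" "q * m \<le> k + q"
        proof -
          have "q * (k div q) + k mod q = k" by simp
          moreover have "k mod q < q" using q by simp
          ultimately show "k \<le> q * m" "q * m \<le> k + q"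
            unfolding m_def distrib_left by linarith+
        qed
        have "x \<le> real (card \<A>) ^ (q * m) * (real (M * n) / real M ^ (q * m) + 2 * L + 1)"
          unfolding x_def X_def using L by (intro card_trapped fin M n) auto
        also have "\<dots> \<le> real (card \<A>) ^ (k + q) * (4 * L)"
        proof (rule mult_mono)
          show "real (card \<A>) ^ (q * m) \<le> real (card \<A>) ^ (k + q)"
            using qm False by (intro power_increasing) auto
          have "real (M * n) \<le> real M ^ (q * m)"
            unfolding NMn N_def of_nat_power using qm M by (intro power_increasing) auto
          then have "real (M * n) / real M ^ (q * m) \<le> 1"
            using M by (simp add: divide_le_eq_1)
          then show "real (M * n) / real M ^ (q * m) + 2 * L + 1 \<le> 4 * L"
            using L by linarith
        qed (use L in auto)
        finally show ?thesis by (simp add: mult_ac)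
      qed
    qed
    have Xsub: "X (q * m) \<subseteq> {..<M * n}"
      unfolding X_def by (rule trapped_subset)
    have Bc: "B \<in> carrier_mat (M * n) (M * n)" by (rule contraction_carrier[OF cB])
    have rank: "(hs_norm (?Q * B ^\<^sub>m m * ?Q))\<^sup>2 \<le> x"
    proof -
      have "hs_norm (?Q * (B ^\<^sub>m m * ?Q)) \<le> hs_norm ?Q"
        using contraction_right[of "M * n" "B ^\<^sub>m m * ?Q" ?Q]
        by (simp add: contraction_mult contraction_pow cB contraction_proj_on)
      also have "?Q * (B ^\<^sub>m m * ?Q) = ?Q * B ^\<^sub>m m * ?Q"
        using Bc by (simp add: assoc_mult_mat[of _ "M * n" "M * n" _ "M * n" _ "M * n"])
      finally have "(hs_norm (?Q * B ^\<^sub>m m * ?Q))\<^sup>2 \<le> (hs_norm ?Q)\<^sup>2"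
        by (intro power_mono) auto
      then show ?thesis
        unfolding hs_norm_proj_on[OF Xsub] x_def .
    qed
    have uncertainty: "(hs_norm (?Q * B ^\<^sub>m m * ?Q))\<^sup>2 \<le> 2 * x\<^sup>2 / N + 2 * C0\<^sup>2 / N" if "q = 1"
    proof -
      have "hs_norm (proj_on (M * n) (X 0) * B ^\<^sub>m m * proj_on (M * n) (- X (0 + m))) \<le> real m * (real (M * n) * e)"
        by (rule propagation[OF cB e small])
      moreover have "proj_on (M * n) (X 0) = 1\<^sub>m (M * n)"
        by (simp add: X_def proj_on_superset)
      moreover have "1\<^sub>m (M * n) * B ^\<^sub>m m = B ^\<^sub>m m"
        using Bc by simp
      ultimately have "hs_norm (B ^\<^sub>m m * proj_on (M * n) (- X (q * m))) \<le> real m * (N * e)"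
        unfolding NMn that by simp
      also have "\<dots> \<le> N * (N * e)"
        using mN N1 e by (intro mult_right_mono) auto
      also have "\<dots> = N ^ 2 * e" by (simp add: power2_eq_square)
      also have "\<dots> \<le> N ^ (q + 3) * e"
        using N1 e by (intro mult_right_mono power_increasing) auto
      also note err
      finally have tail: "hs_norm (B ^\<^sub>m m * proj_on (M * n) (- X (q * m))) \<le> C0 / N" .
      have "hs_norm (?Q * B ^\<^sub>m m * ?Q) \<le> x / sqrt N + hs_norm (B ^\<^sub>m m * proj_on (M * n) (- X (q * m)))"
        using hs_norm_baker_uncertainty[OF chi A n _ Xsub, of m] M
        by (simp add: x_def B_def NMn[symmetric])
      also note tail
      finally have "(hs_norm (?Q * B ^\<^sub>m m * ?Q))\<^sup>2 \<le> (x / sqrt N + C0 / N)\<^sup>2"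
        by (intro power_mono) auto
      also have "\<dots> \<le> 2 * (x / sqrt N)\<^sup>2 + 2 * (C0 / N)\<^sup>2"
        using sum_squares_bound[of "x / sqrt N" "C0 / N"] by (simp add: power2_sum)
      also have "(x / sqrt N)\<^sup>2 = x\<^sup>2 / N"
        using N1 by (simp add: power_divide)
      finally show ?thesis using C0N by simp
    qed
    have sum: "1 / N + C0\<^sup>2 / N + 2 * C0\<^sup>2 / N = (1 + 3 * C0\<^sup>2) / N"
      by (simp add: add_divide_distrib[symmetric])
    have pos: "0 \<le> 2 * C0\<^sup>2 / N" using N1 by simp
    show "\<exists>x. 0 \<le> x \<and> x \<le> 4 * real (card \<A>) ^ (k + q) * real (M ^ k) powr \<tau> \<and>
      real (baker_count M \<A> chi k \<nu>) * (real M powr - \<nu>) ^ (2 * (k div q + 1)) \<le> x + (1 + 3 * C0\<^sup>2) / real (M ^ k) \<and>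
      (q = 1 \<longrightarrow> real (baker_count M \<A> chi k \<nu>) * (real M powr - \<nu>) ^ (2 * (k div q + 1))
         \<le> 2 * x\<^sup>2 / real (M ^ k) + (1 + 3 * C0\<^sup>2) / real (M ^ k))"
      unfolding m_def[symmetric] c_def[symmetric] N_def[symmetric] L_def[symmetric]
    proof (intro exI conjI impI)
      show "0 \<le> x" by (simp add: x_def)
      show "c \<le> x + (1 + 3 * C0\<^sup>2) / N"
        using c_le rank sum pos by linarith
      show "c \<le> 2 * x\<^sup>2 / N + (1 + 3 * C0\<^sup>2) / N" if "q = 1"
        using c_le uncertainty[OF that] sum by linarith
    qed (rule x_le)
  qed simp
qed

lemma card_power_eq_powr:
  assumes "2 \<le> M" "1 \<le> c" "\<delta> = ln (real c) / ln (real M)"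
  shows "real c ^ k = real (M ^ k) powr \<delta>"
proof -
  have "real M powr \<delta> = real c"
    using assms by (simp add: powr_def)
  moreover have "real (M ^ k) powr \<delta> = (real M powr \<delta>) ^ k"
    using assms(1) by (simp add: powr_powr powr_realpow[symmetric] mult.commute)
  ultimately show ?thesis by simp
qed

text \<open>
  Here \<open>m = k div q + 1 \<le> k / q + 1\<close>, and \<open>M\<^sup>k\<close> to the power \<open>1 / q\<close> is \<open>M\<close> to the power \<open>k / q\<close>.
\<close>

lemma divide_by_eigenvalue_power:
  fixes \<nu> a b :: real
  assumes M: "2 \<le> M" and \<nu>: "0 \<le> \<nu>" and q: "1 \<le> q" and a: "0 \<le> a"
    and le: "a * (real M powr - \<nu>) ^ (2 * (k div q + 1)) \<le> b"
  shows "a \<le> real M powr (2 * \<nu>) * real (M ^ k) powr (2 * \<nu> / real q) * b"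
proof -
  define m where "m = k div q + 1"
  have pw: "(real M powr - \<nu>) ^ (2 * m) = real M powr (- (2 * \<nu> * real m))"
    using M by (simp add: powr_powr powr_realpow[symmetric] mult_ac)
  have b: "0 \<le> b" using a le by (meson mult_nonneg_nonneg order_trans powr_ge_zero zero_le_power)
  have "a = real M powr (2 * \<nu> * real m) * (a * (real M powr - \<nu>) ^ (2 * m))"
    unfolding pw using M by (simp add: powr_minus field_simps)
  also have "\<dots> \<le> real M powr (2 * \<nu> * real m) * b"
    using le by (intro mult_left_mono) (auto simp: m_def)
  also have "\<dots> \<le> real M powr (2 * \<nu> + real k * (2 * \<nu> / real q)) * b"
  proof (intro mult_right_mono powr_mono)
    have "real (k div q) \<le> real k / real q" by (rule of_nat_div_le_of_nat)
    then have "2 * \<nu> * real m \<le> 2 * \<nu> * (1 + real k / real q)"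
      using \<nu> by (intro mult_left_mono) (auto simp: m_def)
    then show "2 * \<nu> * real m \<le> 2 * \<nu> + real k * (2 * \<nu> / real q)"
      by (simp add: algebra_simps)
  qed (use M b in auto)
  also have "real M powr (2 * \<nu> + real k * (2 * \<nu> / real q)) = real M powr (2 * \<nu>) * real (M ^ k) powr (2 * \<nu> / real q)"
    using M by (simp add: powr_add powr_powr powr_realpow[symmetric])
  finally show ?thesis .
qed

text \<open>
  With many stages \<open>q\<close> the loss \<open>N\<close> to the power \<open>2 \<nu> / q\<close> is absorbed by \<open>\<epsilon>\<close>, and the number of trapped
  points remains.
\<close>

lemma baker_count_rank_bound:
  fixes chi :: "real \<Rightarrow> real"
  assumes A: "\<A> \<subseteq> {0..<M}" "1 \<le> card \<A>" and M: "2 \<le> M" and chi: "cutoff chi"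
    and \<delta>: "\<delta> = ln (real (card \<A>)) / ln (real M)" and \<nu>: "0 < \<nu>" and \<epsilon>: "0 < \<epsilon>"
  shows "(\<lambda>k. real (baker_count M \<A> chi k \<nu>)) \<in> O(\<lambda>k. real (M ^ k) powr (\<delta> + \<epsilon>))"
proof -
  \<comment> \<open>large enough for \<open>2 * \<nu> / q \<le> \<epsilon> / 2\<close>; the other half of \<open>\<epsilon>\<close> pays for the tolerance \<open>L\<close>\<close>
  define q where "q = Suc (nat \<lceil>4 * \<nu> / \<epsilon>\<rceil>)"
  have q: "1 \<le> q" by (simp add: q_def)
  have "4 * \<nu> / \<epsilon> \<le> real q" unfolding q_def by linarith
  then have q\<epsilon>: "2 * \<nu> / real q \<le> \<epsilon> / 2" using q \<epsilon> by (simp add: field_simps)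
  obtain C where C: "0 \<le> C" and bound:
    "\<And>k. 1 \<le> k \<Longrightarrow> \<exists>x. 0 \<le> x \<and> x \<le> 4 * real (card \<A>) ^ (k + q) * real (M ^ k) powr (\<epsilon> / 2) \<and>
      real (baker_count M \<A> chi k \<nu>) * (real M powr - \<nu>) ^ (2 * (k div q + 1)) \<le> x + C / real (M ^ k)"
    using baker_count_bound[OF A(1) M chi q, of "\<epsilon> / 2" \<nu>] \<epsilon> by (metis half_gt_zero)
  have \<delta>0: "0 \<le> \<delta>" using A(2) M by (simp add: \<delta>)
  define D where "D = real M powr (2 * \<nu>) * (4 * real (card \<A>) ^ q + C)"
  have "real (baker_count M \<A> chi k \<nu>) \<le> D * real (M ^ k) powr (\<delta> + \<epsilon>)" if k: "1 \<le> k" for k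
  proof -
    define N where "N = real (M ^ k)"
    have N1: "1 \<le> N" unfolding N_def using M by (simp del: of_nat_power)
    obtain x where x: "x \<le> 4 * real (card \<A>) ^ (k + q) * N powr (\<epsilon> / 2)"
      "real (baker_count M \<A> chi k \<nu>) * (real M powr - \<nu>) ^ (2 * (k div q + 1)) \<le> x + C / N"
      using bound[OF k] unfolding N_def by blast
    have "real (card \<A>) ^ (k + q) = real (card \<A>) ^ q * N powr \<delta>"
      using card_power_eq_powr[OF M A(2) \<delta>, of k] by (simp add: power_add N_def)
    then have x1: "x \<le> 4 * real (card \<A>) ^ q * N powr (\<delta> + \<epsilon> / 2)"
      using x(1) by (simp add: powr_add mult_ac)
    have "C / N \<le> C * 1"
      using N1 C by (simp add: divide_le_eq mult_left_le mult_le_cancel_left1)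
    also have "\<dots> \<le> C * N powr (\<delta> + \<epsilon> / 2)"
      using N1 C \<delta>0 \<epsilon> by (intro mult_left_mono ge_one_powr_ge_zero) auto
    finally have "x + C / N \<le> (4 * real (card \<A>) ^ q + C) * N powr (\<delta> + \<epsilon> / 2)"
      using x1 by (simp add: distrib_right)
    then have "real (baker_count M \<A> chi k \<nu>) * (real M powr - \<nu>) ^ (2 * (k div q + 1))
        \<le> (4 * real (card \<A>) ^ q + C) * N powr (\<delta> + \<epsilon> / 2)"
      using x(2) by linarith
    from divide_by_eigenvalue_power[OF M _ q _ this] \<nu>
    have "real (baker_count M \<A> chi k \<nu>) \<le> D * (N powr (2 * \<nu> / real q) * N powr (\<delta> + \<epsilon> / 2))"
      by (simp add: D_def N_def mult_ac)
    also have "\<dots> = D * N powr (2 * \<nu> / real q + (\<delta> + \<epsilon> / 2))"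
      by (simp only: powr_add)
    also have "\<dots> \<le> D * N powr (\<delta> + \<epsilon>)"
      using N1 q\<epsilon> C by (intro mult_left_mono powr_mono) (auto simp: D_def)
    finally show ?thesis by (simp add: N_def)
  qed
  then show ?thesis
    by (intro bigoI[of _ D] eventually_at_top_linorderI[of 1]) simp
qed

text \<open>
  A single stage loses the full \<open>N\<close> to the power \<open>2 \<nu>\<close> but gains from the uncertainty estimate: the square of
  the number of trapped points is divided by \<open>N\<close>.
\<close>

lemma baker_count_uncertainty_bound:
  fixes chi :: "real \<Rightarrow> real"
  assumes A: "\<A> \<subseteq> {0..<M}" "1 \<le> card \<A>" and M: "2 \<le> M" and chi: "cutoff chi"
    and \<delta>: "\<delta> = ln (real (card \<A>)) / ln (real M)" and \<nu>: "0 < \<nu>" and \<epsilon>: "0 < \<epsilon>"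
  shows "(\<lambda>k. real (baker_count M \<A> chi k \<nu>)) \<in> O(\<lambda>k. real (M ^ k) powr (2 * \<nu> + 2 * \<delta> - 1 + \<epsilon>))"
proof -
  obtain C where C: "0 \<le> C" and bound:
    "\<And>k. 1 \<le> k \<Longrightarrow> \<exists>x. 0 \<le> x \<and> x \<le> 4 * real (card \<A>) ^ (k + 1) * real (M ^ k) powr (\<epsilon> / 2) \<and>
      real (baker_count M \<A> chi k \<nu>) * (real M powr - \<nu>) ^ (2 * (k div 1 + 1))
        \<le> 2 * x\<^sup>2 / real (M ^ k) + C / real (M ^ k)"
    using baker_count_bound[OF A(1) M chi, of 1 "\<epsilon> / 2" \<nu>] \<epsilon> by (metis half_gt_zero le_refl)
  have \<delta>0: "0 \<le> \<delta>" using A(2) M by (simp add: \<delta>)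
  define D where "D = real M powr (2 * \<nu>) * (32 * (real (card \<A>))\<^sup>2 + C)"
  have "real (baker_count M \<A> chi k \<nu>) \<le> D * real (M ^ k) powr (2 * \<nu> + 2 * \<delta> - 1 + \<epsilon>)" if k: "1 \<le> k" for k
  proof -
    define N where "N = real (M ^ k)"
    have N1: "1 \<le> N" unfolding N_def using M by (simp del: of_nat_power)
    obtain x where x: "0 \<le> x" "x \<le> 4 * real (card \<A>) ^ (k + 1) * N powr (\<epsilon> / 2)"
      "real (baker_count M \<A> chi k \<nu>) * (real M powr - \<nu>) ^ (2 * (k div 1 + 1)) \<le> 2 * x\<^sup>2 / N + C / N"
      using bound[OF k] unfolding N_def by blast
    have pw: "real (card \<A>) ^ (k + 1) = real (card \<A>) * N powr \<delta>"
      using card_power_eq_powr[OF M A(2) \<delta>, of k] by (simp add: N_def)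
    have "x \<le> 4 * real (card \<A>) * N powr (\<delta> + \<epsilon> / 2)"
      using x(2) unfolding pw by (simp add: powr_add mult_ac)
    then have "x\<^sup>2 \<le> (4 * real (card \<A>) * N powr (\<delta> + \<epsilon> / 2))\<^sup>2"
      using x(1) by (rule power_mono)
    also have "\<dots> = 16 * (real (card \<A>))\<^sup>2 * N powr (2 * \<delta> + \<epsilon>)"
      by (simp add: power_mult_distrib power2_eq_square[of "N powr _"] powr_add[symmetric])
    finally have x2: "2 * x\<^sup>2 \<le> 32 * (real (card \<A>))\<^sup>2 * N powr (2 * \<delta> + \<epsilon>)"
      by simp
    have "C * 1 \<le> C * N powr (2 * \<delta> + \<epsilon>)"
      using N1 C \<delta>0 \<epsilon> by (intro mult_left_mono ge_one_powr_ge_zero) auto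
    then have "2 * x\<^sup>2 + C \<le> (32 * (real (card \<A>))\<^sup>2 + C) * N powr (2 * \<delta> + \<epsilon>)"
      using x2 by (simp add: distrib_right)
    then have "(2 * x\<^sup>2 + C) / N \<le> (32 * (real (card \<A>))\<^sup>2 + C) * N powr (2 * \<delta> + \<epsilon>) / N"
      using N1 by (intro divide_right_mono) auto
    also have "\<dots> = (32 * (real (card \<A>))\<^sup>2 + C) * N powr (2 * \<delta> + \<epsilon> - 1)"
      using N1 by (simp add: powr_diff)
    finally have "real (baker_count M \<A> chi k \<nu>) * (real M powr - \<nu>) ^ (2 * (k div 1 + 1))
        \<le> (32 * (real (card \<A>))\<^sup>2 + C) * N powr (2 * \<delta> + \<epsilon> - 1)"
      using x(3) by (simp add: add_divide_distrib)
    from divide_by_eigenvalue_power[OF M _ _ _ this] \<nu>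
    have "real (baker_count M \<A> chi k \<nu>) \<le> D * (N powr (2 * \<nu>) * N powr (2 * \<delta> + \<epsilon> - 1))"
      by (simp add: D_def N_def mult_ac)
    also have "\<dots> = D * N powr (2 * \<nu> + (2 * \<delta> + \<epsilon> - 1))"
      by (simp only: powr_add)
    also have "2 * \<nu> + (2 * \<delta> + \<epsilon> - 1) = 2 * \<nu> + 2 * \<delta> - 1 + \<epsilon>"
      by simp
    finally show ?thesis by (simp only: N_def)
  qed
  then show ?thesis
    by (intro bigoI[of _ D] eventually_at_top_linorderI[of 1]) simp
qed

theorem theorem3:
  fixes M :: nat and \<A> :: "nat set" and chi :: "real \<Rightarrow> real" and \<delta> \<nu> \<epsilon> :: real
  assumes "\<A> \<subseteq> {0..<M}" and "1 < card \<A>" and "card \<A> < M"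
    and "cutoff chi"
    and "\<delta> = ln (real (card \<A>)) / ln (real M)"
    and "\<nu> > 0" and "\<epsilon> > 0"
  shows "(\<lambda>k. real (baker_count M \<A> chi k \<nu>))
    \<in> O(\<lambda>k. real (M ^ k) powr (min (2 * \<nu> + 2 * \<delta> - 1) \<delta> + \<epsilon>))"
proof -
  have M: "2 \<le> M" and A: "1 \<le> card \<A>" using assms(2,3) by auto
  show ?thesis
  proof (cases "2 * \<nu> + 2 * \<delta> - 1 \<le> \<delta>")
    case True
    then show ?thesis
      using baker_count_uncertainty_bound[OF assms(1) A M assms(4-7)] by (simp add: min_absorb1)
  next
    case False
    then show ?thesis
      using baker_count_rank_bound[OF assms(1) A M assms(4-7)] by (simp add: min_absorb2)
  qed
qed

end
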